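(* Let $E$ be a separable real Hilbert space and let $1\leq p<\infty$ be such that $p$ is not an even integer. If $\Phi\colon\mathcal{W}_p(E)\to\mathcal{W}_p(E)$ is an isometry (distance preserving bijection), then there exists an (affine) isometry $\psi\colon E\to E$ such that $\Phi(\mu)=\psi_\#\mu$ for all $\mu\in\mathcal{W}_p(E)$.
   Context: For $1\le p<\infty$, $\mathcal{W}_p(E)$ is the set of Borel probability measures $\mu$ on $E$ with $\int_E\|x\|^p\,d\mu(x)<\infty$, equipped with $d_{\mathcal{W}_p}(\mu,\nu)=\big(\inf_{\pi\in\Pi(\mu,\nu)}\int_{E\times E}\|x-y\|^p\,d\pi(x,y)\big)^{1/p}$, where $\Pi(\mu,\nu)$ is the set of Borel probability measures on $E\times E$ with marginals $\mu$ and $\nu$. For a measurable $g\colon E\to E$, the push-forward is $(g_\#\mu)(A)=\mu(g^{-1}[A])$ for Borel $A$. *)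

theory Defs
  imports "HOL-Probability.Probability"
begin

definition Wasserstein_space :: "real \<Rightarrow> ('a::real_normed_vector) measure set" where
  "Wasserstein_space p = {\<mu>. sets \<mu> = sets borel \<and> prob_space \<mu> \<and>
      (\<integral>\<^sup>+ x. ennreal (norm x powr p) \<partial>\<mu>) < \<infinity>}"

definition couplings :: "('a::topological_space) measure \<Rightarrow> 'a measure \<Rightarrow> ('a \<times> 'a) measure set" where
  "couplings \<mu> \<nu> = {\<pi>. sets \<pi> = sets (borel \<Otimes>\<^sub>M borel) \<and> prob_space \<pi> \<and>
      distr \<pi> borel fst = \<mu> \<and> distr \<pi> borel snd = \<nu>}"

definition wasserstein_dist :: "real \<Rightarrow> ('a::real_normed_vector) measure \<Rightarrow> 'a measure \<Rightarrow> real" where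
  "wasserstein_dist p \<mu> \<nu> =
     (enn2real (INF \<pi>\<in>couplings \<mu> \<nu>. \<integral>\<^sup>+ z. ennreal (norm (fst z - snd z) powr p) \<partial>\<pi>)) powr (1 / p)"

end

theory Submission
  imports Defs
begin

text \<open>
  A measure \<open>\<mu>\<close> is a Dirac measure iff every \<open>\<nu>\<close> is a metric midpoint of \<open>\<mu>\<close> and some \<open>\<eta>\<close>: for Dirac measures
  dilate \<open>\<nu>\<close>, and conversely test with the Dirac measure at the midpoint of two support points of \<open>\<mu>\<close>,
  comparing with the product coupling. Hence \<open>\<Phi>\<close> acts on Dirac measures through an isometry \<open>\<psi>\<close>, and
  \<open>\<Phi> \<mu>\<close> and the push-forward of \<open>\<mu>\<close> under \<open>\<psi>\<close> have the same potential, the integral of \<open>norm (y - x) powr p\<close>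
  over \<open>y\<close>, as a function of \<open>x\<close>.

  For \<open>p\<close> not an even integer this potential determines the measure. Let \<open>\<sigma>\<close> be a difference of two
  probability measures with zero potential and \<open>2 * k < p < 2 * k + 2\<close>. Up to Taylor terms,
  \<open>norm z powr p\<close> is an integral of the Gaussians \<open>exp (- s * (norm z)\<^sup>2)\<close> against
  \<open>s powr (- 1 - p / 2)\<close>. Taking \<open>k\<close> second differences in a direction \<open>u\<close> turns the Taylor terms into
  constants, which \<open>\<sigma>\<close> annihilates, and keeps the Gaussians positive definite. So the nonnegative
  energies of \<open>\<sigma>\<close> for the differenced Gaussian kernels integrate to zero over \<open>s\<close> and therefore vanish, and
  by Cauchy--Schwarz and decay at infinity \<open>\<sigma>\<close> annihilates all Gaussians. As products of Gaussians are
  Gaussians, Weierstrass approximation shows that \<open>\<sigma>\<close> vanishes on finite intersections of balls.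
\<close>

section \<open>Finite differences\<close>

definition fwd_diff :: "'a::ab_group_add \<Rightarrow> ('a \<Rightarrow> real) \<Rightarrow> 'a \<Rightarrow> real" where
  "fwd_diff u f = (\<lambda>z. f (z + u) - f z)"

text \<open>The second difference with its sign reversed, so that it preserves positive definiteness.\<close>

definition sec_diff :: "'a::ab_group_add \<Rightarrow> ('a \<Rightarrow> real) \<Rightarrow> 'a \<Rightarrow> real" where
  "sec_diff u f = (\<lambda>z. 2 * f z - f (z + u) - f (z - u))"

text \<open>Polynomials of degree at most \<open>d\<close> in Frechet's sense: all differences of order \<open>d + 1\<close> vanish.\<close>

fun frechet_poly :: "nat \<Rightarrow> ('a::ab_group_add \<Rightarrow> real) \<Rightarrow> bool" where
  "frechet_poly 0 f \<longleftrightarrow> (\<forall>v. fwd_diff v f = (\<lambda>_. 0))"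
| "frechet_poly (Suc d) f \<longleftrightarrow> (\<forall>v. frechet_poly d (fwd_diff v f))"

lemma frechet_poly_0_eq: "frechet_poly 0 f \<Longrightarrow> f z = f 0"
proof -
  assume "frechet_poly 0 f"
  then have "fwd_diff z f 0 = 0" by simp
  then show ?thesis by (simp add: fwd_diff_def)
qed

lemma frechet_poly_const: "frechet_poly d (\<lambda>_. c)"
proof (induction d arbitrary: c)
  case (Suc d)
  then show ?case by (simp add: fwd_diff_def)
qed (simp add: fwd_diff_def)

lemma frechet_poly_add:
  "frechet_poly d f \<Longrightarrow> frechet_poly d g \<Longrightarrow> frechet_poly d (\<lambda>z. f z + g z)"
proof (induction d arbitrary: f g)
  case 0
  then show ?case by (simp add: fwd_diff_def fun_eq_iff)
next
  case (Suc d)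
  have "fwd_diff v (\<lambda>z. f z + g z) = (\<lambda>z. fwd_diff v f z + fwd_diff v g z)" for v
    by (simp add: fwd_diff_def fun_eq_iff)
  with Suc show ?case by simp
qed

lemma frechet_poly_cmult: "frechet_poly d f \<Longrightarrow> frechet_poly d (\<lambda>z. c * f z)"
proof (induction d arbitrary: f)
  case 0
  then show ?case by (simp add: fwd_diff_def fun_eq_iff)
next
  case (Suc d)
  have "fwd_diff v (\<lambda>z. c * f z) = (\<lambda>z. c * fwd_diff v f z)" for v
    by (simp add: fwd_diff_def fun_eq_iff algebra_simps)
  with Suc show ?case by simp
qed

lemma frechet_poly_shift: "frechet_poly d f \<Longrightarrow> frechet_poly d (\<lambda>z. f (z + w))"
proof (induction d arbitrary: f)
  case 0
  then show ?case by (simp add: fwd_diff_def fun_eq_iff add_ac)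
next
  case (Suc d)
  have "fwd_diff v (\<lambda>z. f (z + w)) = (\<lambda>z. fwd_diff v f (z + w))" for v
    by (simp add: fwd_diff_def fun_eq_iff add_ac)
  with Suc show ?case by simp
qed

lemma frechet_poly_Suc: "frechet_poly d f \<Longrightarrow> frechet_poly (Suc d) f"
proof (induction d arbitrary: f)
  case 0
  then have "fwd_diff v f = (\<lambda>_. 0)" for v by simp
  then show ?case by (simp add: fwd_diff_def)
next
  case (Suc d)
  show ?case
    unfolding frechet_poly.simps(2)[of "Suc d"] using Suc by simp
qed

lemma frechet_poly_mono: "d \<le> e \<Longrightarrow> frechet_poly d f \<Longrightarrow> frechet_poly e f"
  by (induction e rule: dec_induct) (blast intro: frechet_poly_Suc)+

text \<open>The discrete Leibniz rule writes a difference of the product as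
  \<open>fwd_diff v f z * g (z + v) + f z * fwd_diff v g z\<close>, and in each summand one factor
  has dropped a degree. Degree 0 is split off because constants have no lower degree to drop
  to.\<close>

lemma frechet_poly_mult:
  "frechet_poly a f \<Longrightarrow> frechet_poly b g \<Longrightarrow> frechet_poly (a + b) (\<lambda>z. f z * g z)"
proof (induction "a + b" arbitrary: a b f g rule: less_induct)
  case less
  show ?case
  proof (cases a)
    case 0
    with less(2) have "f = (\<lambda>_. f 0)" using frechet_poly_0_eq by blast
    then have "(\<lambda>z. f z * g z) = (\<lambda>z. f 0 * g z)" by metis
    then show ?thesis using less(3) 0 frechet_poly_cmult by simp
  next
    case (Suc a')
    show ?thesis
    proof (cases b)
      case 0
      with less(3) have "g = (\<lambda>_. g 0)" using frechet_poly_0_eq by blast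
      then have "(\<lambda>z. f z * g z) = (\<lambda>z. g 0 * f z)" by (metis mult.commute)
      then show ?thesis using less(2) 0 frechet_poly_cmult by simp
    next
      case (Suc b')
      have "frechet_poly (a' + b) (fwd_diff v (\<lambda>z. f z * g z))" for v
      proof -
        have 1: "frechet_poly (a' + b) (\<lambda>z. fwd_diff v f z * g (z + v))"
          using less.hyps[of a' b "fwd_diff v f" "\<lambda>z. g (z + v)"] less(2,3) \<open>a = Suc a'\<close>
          by (simp add: frechet_poly_shift)
        have 2: "frechet_poly (a' + b) (\<lambda>z. f z * fwd_diff v g z)"
          using less.hyps[of a b' f "fwd_diff v g"] less(2,3) \<open>a = Suc a'\<close> \<open>b = Suc b'\<close> by simp
        have "fwd_diff v (\<lambda>z. f z * g z) =
            (\<lambda>z. fwd_diff v f z * g (z + v) + f z * fwd_diff v g z)"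
          by (simp add: fwd_diff_def fun_eq_iff algebra_simps)
        then show ?thesis using frechet_poly_add[OF 1 2] by simp
      qed
      then show ?thesis using \<open>a = Suc a'\<close> by simp
    qed
  qed
qed

text \<open>By bilinearity the first difference of the squared norm is affine, the second is
  constant and the third vanishes.\<close>

lemma frechet_poly_norm_sq: "frechet_poly 2 (\<lambda>z::'a::real_inner. (norm z)\<^sup>2)"
  by (simp add: numeral_2_eq_2 fwd_diff_def power2_norm_eq_inner[unfolded numeral_2_eq_2]
      inner_add_left inner_add_right fun_eq_iff inner_commute del: power_Suc)

lemma frechet_poly_norm_power: "frechet_poly (2 * j) (\<lambda>z::'a::real_inner. ((norm z)\<^sup>2) ^ j)"
proof (induction j)
  case (Suc j)
  then show ?case using frechet_poly_mult[OF frechet_poly_norm_sq Suc] by simp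
qed (simp add: frechet_poly_const fwd_diff_def)

lemma sec_diff_eq_fwd_diff: "sec_diff u f z = - fwd_diff u (fwd_diff u f) (z - u)"
  by (simp add: sec_diff_def fwd_diff_def algebra_simps)

lemma frechet_poly_sec_diff:
  assumes "frechet_poly (Suc (Suc d)) f" shows "frechet_poly d (sec_diff u f)"
proof -
  have "frechet_poly d (fwd_diff u (fwd_diff u f))" using assms by simp
  from frechet_poly_cmult[OF frechet_poly_shift[OF this, of "- u"], of "-1"]
  show ?thesis by (simp add: sec_diff_eq_fwd_diff[abs_def])
qed

text \<open>Up to sign and shift a second difference is a double forward difference, so each one
  lowers the degree by two. This is what reduces the Taylor terms to constants.\<close>

lemma frechet_poly_sec_diff_iter:
  "frechet_poly (2 * k) f \<Longrightarrow> frechet_poly 0 ((sec_diff u ^^ k) f)"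
proof (induction k arbitrary: f)
  case (Suc k)
  then have "frechet_poly (2 * k) (sec_diff u f)" by (intro frechet_poly_sec_diff) simp
  from Suc.IH[OF this] show ?case by (simp add: funpow_swap1)
qed simp

text \<open>One choice of coefficients and shifts serves all \<open>f\<close> and \<open>z\<close>.
  Continuity, bounds and exchange with integrals are then read off from a finite sum.\<close>

lemma sec_diff_iter_repr:
  fixes u :: "'a::ab_group_add"
  shows "\<exists>(n::nat) c w. \<forall>f z. (sec_diff u ^^ k) f z = (\<Sum>i<n. c i * f (z + w i))"
proof (induction k)
  case 0
  show ?case by (intro exI[of _ 1] exI[of _ "\<lambda>_. 1"] exI[of _ "\<lambda>_. 0"]) simp
next
  case (Suc k)
  then obtain n c w where *: "\<And>f z. (sec_diff u ^^ k) f z = (\<Sum>i<(n::nat). c i * f (z + w i))"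
    by blast
  define c' where "c' i = (if i < n then 2 * c i else if i < 2 * n then - c (i - n) else - c (i - 2 * n))" for i
  define w' where "w' i = (if i < n then w i else if i < 2 * n then w (i - n) + u else w (i - 2 * n) - u)" for i
  have split: "(\<Sum>i<3 * n. g i) = (\<Sum>i<n. g i) + (\<Sum>i<n. g (i + n)) + (\<Sum>i<n. g (i + 2 * n))" for g :: "nat \<Rightarrow> real"
  proof -
    have "(\<Sum>i<3 * n. g i) = (\<Sum>i=0..<n. g i) + (\<Sum>i=n..<2 * n. g i) + (\<Sum>i=2*n..<3 * n. g i)"
      by (simp add: sum.atLeastLessThan_concat lessThan_atLeast0)
    moreover have "(\<Sum>i=n..<2 * n. g i) = (\<Sum>i<n. g (i + n))"
      using sum.shift_bounds_nat_ivl[of g 0 n n] by (simp add: lessThan_atLeast0 mult_2)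
    moreover have "(\<Sum>i=2*n..<3 * n. g i) = (\<Sum>i<n. g (i + 2 * n))"
      using sum.shift_bounds_nat_ivl[of g 0 "2*n" n] by (simp add: lessThan_atLeast0)
    ultimately show ?thesis by (simp add: lessThan_atLeast0)
  qed
  have "(sec_diff u ^^ Suc k) f z = (\<Sum>i<3 * n. c' i * f (z + w' i))" for f z
  proof -
    have "(\<Sum>i<3 * n. c' i * f (z + w' i)) = (\<Sum>i<n. 2 * c i * f (z + w i)) +
       (\<Sum>i<n. - c i * f (z + w i + u)) + (\<Sum>i<n. - c i * f (z + w i - u))"
      unfolding split by (simp add: c'_def w'_def algebra_simps)
    also have "\<dots> = (sec_diff u ^^ Suc k) f z"
      by (simp add: sec_diff_def * sum_distrib_left sum_negf algebra_simps)
    finally show ?thesis by simp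
  qed
  then show ?case by blast
qed

text \<open>A vanishing difference makes \<open>f\<close> periodic with period \<open>u\<close>, and
  a periodic function that tends to 0 along its period is 0.\<close>

lemma fwd_diff_decay_zero:
  fixes f :: "'a::real_vector \<Rightarrow> real"
  assumes decay: "\<And>z. (\<lambda>n. f (z + real n *\<^sub>R u)) \<longlonglongrightarrow> 0" and zero: "\<And>z. fwd_diff u f z = 0"
  shows "f z = 0"
proof -
  have "f (z + real n *\<^sub>R u) = f z" for n
  proof (induction n)
    case (Suc n)
    then show ?case using zero[of "z + real n *\<^sub>R u"] by (simp add: fwd_diff_def algebra_simps)
  qed simp
  with decay[of z] show ?thesis by (simp add: LIMSEQ_const_iff)
qed

text \<open>Differences inherit the decay, so the second differences can be peeled off one at a
  time, each as two forward differences.\<close>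

lemma sec_diff_iter_decay_zero:
  fixes f :: "'a::real_vector \<Rightarrow> real"
  assumes "\<And>z. (\<lambda>n. f (z + real n *\<^sub>R u)) \<longlonglongrightarrow> 0" and "\<And>z. (sec_diff u ^^ k) f z = 0"
  shows "f z = 0"
  using assms
proof (induction k arbitrary: f z)
  case (Suc k)
  have shift: "(\<lambda>n. f (x + v + real n *\<^sub>R u)) \<longlonglongrightarrow> 0" for x v
    using Suc.prems(1)[of "x + v"] .
  have sh1: "(\<lambda>n. f (x + real n *\<^sub>R u + v)) \<longlonglongrightarrow> 0" for x v
    using shift[of x v] by (simp add: add_ac)
  have sh2: "(\<lambda>n. f (x + real n *\<^sub>R u - v)) \<longlonglongrightarrow> 0" for x v
    using sh1[of x "-v"] by simp
  have "(\<lambda>n. sec_diff u f (x + real n *\<^sub>R u)) \<longlonglongrightarrow> 2 * 0 - 0 - 0" for x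
    unfolding sec_diff_def by (intro tendsto_intros Suc.prems(1) sh1 sh2)
  then have U0: "sec_diff u f x = 0" for x
    using Suc.prems(2) Suc.IH[of "sec_diff u f" x] by (simp add: funpow_swap1)
  have "fwd_diff u (fwd_diff u f) x = 0" for x
    using U0[of "x + u"] by (simp add: sec_diff_eq_fwd_diff)
  moreover have "(\<lambda>n. fwd_diff u f (x + real n *\<^sub>R u)) \<longlonglongrightarrow> 0 - 0" for x
    unfolding fwd_diff_def by (intro tendsto_intros Suc.prems(1) sh1)
  ultimately have "fwd_diff u f x = 0" for x
    using fwd_diff_decay_zero[of "fwd_diff u f" u] by simp
  then show ?case using fwd_diff_decay_zero[of f u] Suc.prems(1) by blast
qed simp

section \<open>Positive definite functions\<close>

text \<open>A list of weighted points stands for a finitely supported signed measure. Points may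
  repeat, so sums, translates and reweightings of measures are plain list operations without any
  merging of weights.\<close>

definition wsum :: "(real \<times> 'a) list \<Rightarrow> ('a \<Rightarrow> real) \<Rightarrow> real" where
  "wsum xs f = (\<Sum>(a, x)\<leftarrow>xs. a * f x)"

lemma wsum_Nil [simp]: "wsum [] f = 0"
  and wsum_Cons [simp]: "wsum ((a, x) # xs) f = a * f x + wsum xs f"
  by (simp_all add: wsum_def)

lemma wsum_append [simp]: "wsum (xs @ ys) f = wsum xs f + wsum ys f"
  by (simp add: wsum_def)

lemma wsum_add: "wsum xs (\<lambda>x. f x + g x) = wsum xs f + wsum xs g"
  by (induction xs) (auto simp: algebra_simps)

lemma wsum_diff: "wsum xs (\<lambda>x. f x - g x) = wsum xs f - wsum xs g"
  by (induction xs) (auto simp: algebra_simps)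

lemma wsum_cmult: "wsum xs (\<lambda>x. c * f x) = c * wsum xs f"
  by (induction xs) (auto simp: algebra_simps)

lemma wsum_sum: "wsum xs (\<lambda>x. \<Sum>i\<in>I. f i x) = (\<Sum>i\<in>I. wsum xs (f i))"
  by (induction xs) (auto simp: algebra_simps sum.distrib sum_distrib_left)

lemma wsum_cong: "(\<And>x. x \<in> snd ` set xs \<Longrightarrow> f x = g x) \<Longrightarrow> wsum xs f = wsum xs g"
  by (induction xs) auto

lemma wsum_reweight: "wsum (map (\<lambda>(a, x). (a * g x, x)) xs) f = wsum xs (\<lambda>x. g x * f x)"
  by (induction xs) auto

lemma wsum_shift: "wsum (map (\<lambda>(a, x). (- a, x + u)) xs) f = - wsum xs (\<lambda>x. f (x + u))"
  by (induction xs) auto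

lemma wsum_sums:
  assumes "\<And>x. (\<lambda>n. f n x) sums g x" shows "(\<lambda>n. wsum xs (f n)) sums wsum xs g"
proof (induction xs)
  case (Cons ax xs)
  then show ?case using assms by (cases ax) (auto intro!: sums_add sums_mult)
qed simp

definition pos_def_fun :: "('a::ab_group_add \<Rightarrow> real) \<Rightarrow> bool" where
  "pos_def_fun \<phi> \<longleftrightarrow> (\<forall>xs. 0 \<le> wsum xs (\<lambda>x. wsum xs (\<lambda>y. \<phi> (x - y))))"

text \<open>The quadratic form of \<open>sec_diff u \<phi>\<close> at a finite signed measure is the
  quadratic form of \<open>\<phi>\<close> at that measure minus its translate by
  \<open>u\<close>.\<close>

lemma pos_def_fun_sec_diff:
  assumes "pos_def_fun \<phi>" shows "pos_def_fun (sec_diff u \<phi>)"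
  unfolding pos_def_fun_def
proof
  fix xs :: "(real \<times> 'a) list"
  define ys where "ys = xs @ map (\<lambda>(a, x). (- a, x + u)) xs"
  have ys: "wsum ys f = wsum xs (\<lambda>x. f x - f (x + u))" for f
    by (simp add: ys_def wsum_shift wsum_diff)
  have "wsum ys (\<lambda>x. wsum ys (\<lambda>y. \<phi> (x - y))) =
      wsum xs (\<lambda>x. wsum xs (\<lambda>y. (\<phi> (x - y) - \<phi> (x - (y + u))) - (\<phi> (x + u - y) - \<phi> (x + u - (y + u)))))"
    by (simp only: ys wsum_diff)
  also have "\<dots> = wsum xs (\<lambda>x. wsum xs (\<lambda>y. sec_diff u \<phi> (x - y)))"
    by (simp add: sec_diff_def algebra_simps)
  finally show "0 \<le> wsum xs (\<lambda>x. wsum xs (\<lambda>y. sec_diff u \<phi> (x - y)))"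
    using assms unfolding pos_def_fun_def by metis
qed

lemma pos_def_fun_sec_diff_iter: "pos_def_fun \<phi> \<Longrightarrow> pos_def_fun ((sec_diff u ^^ k) \<phi>)"
  by (induction k) (auto intro: pos_def_fun_sec_diff)

text \<open>Gram--Schmidt: a new point contributes its normalised residual after projection to the
  span of \<open>B\<close>, unless that residual is 0.\<close>

lemma finite_orthonormal_expansion:
  fixes X :: "'a::real_inner set"
  assumes "finite X"
  obtains B where "finite B" "\<And>b c. b \<in> B \<Longrightarrow> c \<in> B \<Longrightarrow> b \<bullet> c = (if b = c then 1 else 0)"
    "\<And>x. x \<in> X \<Longrightarrow> x = (\<Sum>b\<in>B. (x \<bullet> b) *\<^sub>R b)"
proof -
  have "\<exists>B. finite B \<and> (\<forall>b\<in>B. \<forall>c\<in>B. b \<bullet> c = (if b = c then 1 else 0)) \<and>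
     (\<forall>x\<in>X. x = (\<Sum>b\<in>B. (x \<bullet> b) *\<^sub>R b))"
    using assms
  proof induction
    case empty
    show ?case by (intro exI[of _ "{}"]) simp
  next
    case (insert x X)
    then obtain B where B: "finite B" "\<And>b c. b \<in> B \<Longrightarrow> c \<in> B \<Longrightarrow> b \<bullet> c = (if b = c then 1 else 0)"
      "\<And>x. x \<in> X \<Longrightarrow> x = (\<Sum>b\<in>B. (x \<bullet> b) *\<^sub>R b)" by blast
    define r where "r = x - (\<Sum>b\<in>B. (x \<bullet> b) *\<^sub>R b)"
    have rB: "r \<bullet> c = 0" if "c \<in> B" for c
    proof -
      have "(\<Sum>b\<in>B. (x \<bullet> b) *\<^sub>R b) \<bullet> c = (\<Sum>b\<in>B. if b = c then x \<bullet> b else 0)"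
        unfolding inner_sum_left using that by (intro sum.cong) (auto simp: B(2))
      then show ?thesis using that B(1) by (simp add: r_def inner_diff_left)
    qed
    show ?case
    proof (cases "r = 0")
      case True
      then show ?thesis using B by (intro exI[of _ B]) (auto simp: r_def)
    next
      case False
      define e where "e = sgn r"
      have e1: "e \<bullet> e = 1" using False by (simp add: e_def dot_square_norm norm_sgn)
      have eB: "e \<bullet> c = 0" "c \<bullet> e = 0" if "c \<in> B" for c
        using rB[OF that] by (auto simp: e_def sgn_div_norm inner_commute)
      have eN: "e \<notin> B" using eB(1)[of e] e1 by auto
      have yB: "(\<Sum>b\<in>B. (y \<bullet> b) *\<^sub>R b) \<bullet> e = 0" for y
        by (simp add: inner_sum_left eB)
      have "y \<bullet> e = 0" if "y \<in> X" for y using B(3)[OF that] yB[of y] by simp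
      moreover have "x \<bullet> e = norm r"
      proof -
        have "x = r + (\<Sum>b\<in>B. (x \<bullet> b) *\<^sub>R b)" by (simp add: r_def)
        then have "x \<bullet> e = r \<bullet> e" using yB[of x] by (metis add.right_neutral inner_add_left)
        also have "\<dots> = norm r"
          using False by (simp add: e_def sgn_div_norm dot_square_norm power2_eq_square)
        finally show ?thesis .
      qed
      moreover have "norm r *\<^sub>R e = r" using False by (simp add: e_def sgn_div_norm)
      ultimately have "y = (\<Sum>b\<in>insert e B. (y \<bullet> b) *\<^sub>R b)" if "y \<in> insert x X" for y
        using that B(1,3) eN by (auto simp: r_def)
      then show ?thesis using B(1,2) e1 eB eN by (intro exI[of _ "insert e B"]) auto
    qed
  qed
  with that show thesis by blast
qed

text \<open>Only \<open>x\<close> has to lie in the span of \<open>B\<close>, since the part of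
  \<open>y\<close> orthogonal to it does not contribute.\<close>

lemma inner_orthonormal_expansion:
  fixes X :: "'a::real_inner set"
  assumes "finite X"
  obtains B where "finite B" "\<And>x y. x \<in> X \<Longrightarrow> x \<bullet> y = (\<Sum>b\<in>B. (x \<bullet> b) * (y \<bullet> b))"
proof -
  obtain B where B: "finite B" "\<And>x. x \<in> X \<Longrightarrow> x = (\<Sum>b\<in>B. (x \<bullet> b) *\<^sub>R b)"
    using finite_orthonormal_expansion[OF assms] by metis
  have "x \<bullet> y = (\<Sum>b\<in>B. (x \<bullet> b) * (y \<bullet> b))" if "x \<in> X" for x y
  proof -
    have "x \<bullet> y = (\<Sum>b\<in>B. (x \<bullet> b) *\<^sub>R b) \<bullet> y" using B(2)[OF that] by (rule arg_cong)
    also have "\<dots> = (\<Sum>b\<in>B. (x \<bullet> b) * (y \<bullet> b))" 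
      unfolding inner_sum_left by (intro sum.cong) (auto simp: inner_commute)
    finally show ?thesis .
  qed
  with B(1) that show thesis by blast
qed

text \<open>The Schur product argument: one factor \<open>x \<bullet> y\<close> is expanded over an
  orthonormal family, its coordinates are absorbed into the weights, and what remains is a sum of
  quadratic forms for the next lower power.\<close>

lemma wsum_inner_power_nonneg:
  fixes xs :: "(real \<times> 'a::real_inner) list"
  shows "0 \<le> wsum xs (\<lambda>x. wsum xs (\<lambda>y. (x \<bullet> y) ^ n))"
proof (induction n arbitrary: xs)
  case 0
  have "wsum xs (\<lambda>_. 1 * wsum xs (\<lambda>_. 1)) = wsum xs (\<lambda>_. 1) * wsum xs (\<lambda>_. 1)"
    using wsum_cmult[of xs "wsum xs (\<lambda>_. 1)" "\<lambda>_. 1"] by simp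
  then show ?case by simp
next
  case (Suc n)
  obtain B where B: "finite B" "\<And>x y. x \<in> snd ` set xs \<Longrightarrow> x \<bullet> y = (\<Sum>b\<in>B. (x \<bullet> b) * (y \<bullet> b))"
    using inner_orthonormal_expansion[of "snd ` set xs"] by auto
  define ys where "ys b = map (\<lambda>(a, x). (a * (x \<bullet> b), x)) xs" for b
  have "wsum xs (\<lambda>x. wsum xs (\<lambda>y. (x \<bullet> y) ^ Suc n)) =
     wsum xs (\<lambda>x. wsum xs (\<lambda>y. \<Sum>b\<in>B. (x \<bullet> b) * ((y \<bullet> b) * (x \<bullet> y) ^ n)))"
  proof (intro wsum_cong)
    fix x y assume "x \<in> snd ` set xs"
    then have "(x \<bullet> y) ^ Suc n = (\<Sum>b\<in>B. (x \<bullet> b) * (y \<bullet> b)) * (x \<bullet> y) ^ n"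
      unfolding power_Suc by (metis B(2))
    also have "\<dots> = (\<Sum>b\<in>B. (x \<bullet> b) * ((y \<bullet> b) * (x \<bullet> y) ^ n))"
      by (simp only: sum_distrib_right mult.assoc)
    finally show "(x \<bullet> y) ^ Suc n = (\<Sum>b\<in>B. (x \<bullet> b) * ((y \<bullet> b) * (x \<bullet> y) ^ n))" .
  qed
  also have "\<dots> = (\<Sum>b\<in>B. wsum (ys b) (\<lambda>x. wsum (ys b) (\<lambda>y. (x \<bullet> y) ^ n)))"
    by (simp add: wsum_sum wsum_cmult ys_def wsum_reweight)
  also have "\<dots> \<ge> 0" by (intro sum_nonneg Suc.IH)
  finally show ?case .
qed

text \<open>Expanding the square gives \<open>g x * g y * exp (2 * s * (x \<bullet> y))\<close>. The
  factors \<open>g\<close> go into the weights, and the exponential is a power series in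
  \<open>x \<bullet> y\<close> with nonnegative coefficients.\<close>

lemma pos_def_fun_gaussian:
  fixes s :: real assumes "s \<ge> 0"
  shows "pos_def_fun (\<lambda>z::'a::real_inner. exp (- (s * (norm z)\<^sup>2)))"
  unfolding pos_def_fun_def
proof
  fix xs :: "(real \<times> 'a) list"
  define g where "g x = exp (- (s * (norm x)\<^sup>2))" for x :: 'a
  define ys where "ys = map (\<lambda>(a, x). (a * g x, x)) xs"
  have "exp (- (s * (norm (x - y))\<^sup>2)) = g x * (g y * exp (2 * s * (x \<bullet> y)))" for x y :: 'a
    by (simp add: g_def power2_norm_eq_inner inner_diff_left inner_diff_right inner_commute
        algebra_simps flip: exp_add)
  note gauss = this
  have eq: "wsum xs (\<lambda>x. wsum xs (\<lambda>y. exp (- (s * (norm (x - y))\<^sup>2)))) =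
      wsum ys (\<lambda>x. wsum ys (\<lambda>y. exp (2 * s * (x \<bullet> y))))"
    by (simp only: ys_def wsum_reweight wsum_cmult gauss)
  have "(\<lambda>n. ((2 * s) ^ n / fact n) * (x \<bullet> y) ^ n) sums exp (2 * s * (x \<bullet> y))" for x y :: 'a
    using exp_converges[of "2 * s * (x \<bullet> y)"] by (simp add: power_mult_distrib divide_inverse mult_ac)
  then have "(\<lambda>n. wsum ys (\<lambda>x. wsum ys (\<lambda>y. ((2 * s) ^ n / fact n) * (x \<bullet> y) ^ n))) sums
      wsum ys (\<lambda>x. wsum ys (\<lambda>y. exp (2 * s * (x \<bullet> y))))"
    by (intro wsum_sums)
  moreover have "wsum ys (\<lambda>x. wsum ys (\<lambda>y. ((2 * s) ^ n / fact n) * (x \<bullet> y) ^ n)) \<ge> 0" for n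
    unfolding wsum_cmult using assms by (intro mult_nonneg_nonneg wsum_inner_power_nonneg) auto
  ultimately have "0 \<le> wsum ys (\<lambda>x. wsum ys (\<lambda>y. exp (2 * s * (x \<bullet> y))))"
    by (rule sums_le[OF _ sums_zero, rotated])
  with eq show "0 \<le> wsum xs (\<lambda>x. wsum xs (\<lambda>y. exp (- (s * (norm (x - y))\<^sup>2))))" by simp
qed

section \<open>Positive definite kernels and signed measures\<close>

text \<open>The functional \<open>L\<close> below is integration against a signed measure of total mass zero, written as
  the image under \<open>X\<close> of a density \<open>\<epsilon>\<close> with respect to an unsigned measure.\<close>

locale signed_functional = finite_measure M for M :: "'w measure" +
  fixes \<epsilon> :: "'w \<Rightarrow> real" and X :: "'w \<Rightarrow> 'a::{real_inner, polish_space}"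
  assumes eps_measurable [measurable]: "\<epsilon> \<in> borel_measurable M"
    and X_measurable [measurable]: "X \<in> borel_measurable M"
    and eps_bounded: "\<And>\<omega>. \<bar>\<epsilon> \<omega>\<bar> \<le> 1"
    and eps_balanced: "(\<integral>\<omega>. \<epsilon> \<omega> \<partial>M) = 0"
begin

definition L :: "('a \<Rightarrow> real) \<Rightarrow> real" where
  "L h = (\<integral>\<omega>. \<epsilon> \<omega> * h (X \<omega>) \<partial>M)"

lemma abs_eps_mult_le: "\<bar>a\<bar> \<le> K \<Longrightarrow> \<bar>\<epsilon> \<omega> * a\<bar> \<le> K"
  unfolding abs_mult using mult_mono[OF eps_bounded, of "\<bar>a\<bar>" K] by simp

lemma integrable_eps_mult:
  assumes [measurable]: "g \<in> borel_measurable M" and "\<And>\<omega>. \<bar>g \<omega>\<bar> \<le> K"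
  shows "integrable M (\<lambda>\<omega>. \<epsilon> \<omega> * g \<omega>)"
  using assms by (intro integrable_const_bound[of _ K]) (auto intro!: abs_eps_mult_le)

lemma abs_integral_eps_le:
  assumes "g \<in> borel_measurable M" and "\<And>\<omega>. \<bar>g \<omega>\<bar> \<le> K"
  shows "\<bar>\<integral>\<omega>. \<epsilon> \<omega> * g \<omega> \<partial>M\<bar> \<le> K * measure M (space M)"
proof -
  have "\<bar>\<integral>\<omega>. \<epsilon> \<omega> * g \<omega> \<partial>M\<bar> \<le> (\<integral>\<omega>. \<bar>\<epsilon> \<omega> * g \<omega>\<bar> \<partial>M)"
    by (rule integral_abs_bound)
  also have "\<dots> \<le> (\<integral>\<omega>. K \<partial>M)"
    using assms by (intro integral_mono integrable_abs integrable_eps_mult[of _ K] abs_eps_mult_le) auto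
  finally have "\<bar>\<integral>\<omega>. \<epsilon> \<omega> * g \<omega> \<partial>M\<bar> \<le> (\<integral>\<omega>. K \<partial>M)" .
  then show ?thesis by (simp add: mult.commute)
qed

lemma integrable_L:
  assumes "h \<in> borel_measurable borel" and "\<And>x. \<bar>h x\<bar> \<le> K"
  shows "integrable M (\<lambda>\<omega>. \<epsilon> \<omega> * h (X \<omega>))"
  using assms by (intro integrable_eps_mult) auto

text \<open>If \<open>F\<close> has finitely many values, the signed measure is finitely supported;
  the weight of a value is the integral of \<open>\<epsilon>\<close> over its fibre. This connects
  integrals with the finite sums in \<open>pos_def_fun\<close>.\<close>

lemma L_simple_approx:
  assumes "simple_function M F"
  obtains xs where "\<And>h. (\<integral>\<omega>. \<epsilon> \<omega> * h (F \<omega>) \<partial>M) = wsum xs h"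
proof -
  define V where "V = F ` space M"
  define c where "c v = (\<integral>\<omega>. \<epsilon> \<omega> * indicator (F -` {v} \<inter> space M) \<omega> \<partial>M)" for v
  have fin: "finite V" using assms by (simp add: V_def simple_function_def)
  then obtain vs where vs: "set vs = V" "distinct vs" using finite_distinct_list by blast
  have int: "integrable M (\<lambda>\<omega>. \<epsilon> \<omega> * indicator (F -` {v} \<inter> space M) \<omega>)" if "v \<in> V" for v
    using assms that by (intro integrable_eps_mult[of _ 1])
      (auto simp: simple_function_def V_def intro!: borel_measurable_indicator split: split_indicator)
  have "(\<integral>\<omega>. \<epsilon> \<omega> * h (F \<omega>) \<partial>M) = wsum (map (\<lambda>v. (c v, v)) vs) h" for h
  proof -
    have "(\<integral>\<omega>. \<epsilon> \<omega> * h (F \<omega>) \<partial>M) =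
       (\<integral>\<omega>. (\<Sum>v\<in>V. (\<epsilon> \<omega> * indicator (F -` {v} \<inter> space M) \<omega>) * h v) \<partial>M)"
    proof (rule Bochner_Integration.integral_cong[OF refl])
      fix \<omega> assume "\<omega> \<in> space M"
      then have "(\<Sum>v\<in>V. (\<epsilon> \<omega> * indicator (F -` {v} \<inter> space M) \<omega>) * h v) =
          (\<Sum>v\<in>V. if v = F \<omega> then \<epsilon> \<omega> * h v else 0)"
        by (intro sum.cong) (auto simp: indicator_def)
      then show "\<epsilon> \<omega> * h (F \<omega>) = (\<Sum>v\<in>V. (\<epsilon> \<omega> * indicator (F -` {v} \<inter> space M) \<omega>) * h v)"
        using fin \<open>\<omega> \<in> space M\<close> by (simp add: V_def)
    qed
    also have "\<dots> = (\<Sum>v\<in>V. c v * h v)"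
      unfolding c_def using int by (subst Bochner_Integration.integral_sum) auto
    also have "\<dots> = wsum (map (\<lambda>v. (c v, v)) vs) h"
      using vs by (simp add: wsum_def comp_def sum_list_distinct_conv_sum_set)
    finally show ?thesis .
  qed
  then show thesis by (rule that)
qed

text \<open>The expression is the quadratic form of \<open>\<phi>\<close> at the signed measure plus
  \<open>t\<close> times the point mass at \<open>x0\<close>. It is nonnegative when
  \<open>X\<close> is replaced by simple functions, and dominated convergence carries this over to
  \<open>X\<close>.\<close>

lemma pos_def_fun_integral_nonneg:
  fixes \<phi> :: "'a \<Rightarrow> real"
  assumes pd: "pos_def_fun \<phi>" and cont: "continuous_on UNIV \<phi>" and bd: "\<And>z. \<bar>\<phi> z\<bar> \<le> K"
  shows "0 \<le> L (\<lambda>x. L (\<lambda>y. \<phi> (x - y))) + t * L (\<lambda>x. \<phi> (x - x0)) + t * L (\<lambda>y. \<phi> (x0 - y)) + t * t * \<phi> 0"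
proof -
  obtain F where F: "\<And>n. simple_function M (F n)" "\<And>\<omega>. \<omega> \<in> space M \<Longrightarrow> (\<lambda>n. F n \<omega>) \<longlonglongrightarrow> X \<omega>"
    using borel_measurable_implies_sequence_metric[OF X_measurable] by blast
  have [measurable]: "F n \<in> borel_measurable M" for n
    using F(1) by (rule borel_measurable_simple_function)
  have [measurable]: "\<phi> \<in> borel_measurable borel"
    using cont by (rule borel_measurable_continuous_onI)
  have lim: "(\<lambda>n. \<phi> (f n)) \<longlonglongrightarrow> \<phi> z" if "f \<longlonglongrightarrow> z" for f z
    using that cont by (auto simp: continuous_on_def intro: tendsto_compose)
  define Ln where "Ln n h = (\<integral>\<omega>. \<epsilon> \<omega> * h (F n \<omega>) \<partial>M)" for n and h :: "'a \<Rightarrow> real"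
  have l1: "(\<lambda>n. Ln n (\<lambda>x. \<phi> (x - x0))) \<longlonglongrightarrow> L (\<lambda>x. \<phi> (x - x0))"
    unfolding Ln_def L_def
    by (rule integral_dominated_convergence[where w="\<lambda>_. K"])
      (auto intro!: tendsto_intros lim F abs_eps_mult_le bd)
  have l2: "(\<lambda>n. Ln n (\<lambda>x. \<phi> (x0 - x))) \<longlonglongrightarrow> L (\<lambda>x. \<phi> (x0 - x))"
    unfolding Ln_def L_def
    by (rule integral_dominated_convergence[where w="\<lambda>_. K"])
      (auto intro!: tendsto_intros lim F abs_eps_mult_le bd)
  have l3: "(\<lambda>n. Ln n (\<lambda>x. Ln n (\<lambda>y. \<phi> (x - y)))) \<longlonglongrightarrow> L (\<lambda>x. L (\<lambda>y. \<phi> (x - y)))"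
    unfolding Ln_def L_def
  proof (rule integral_dominated_convergence[where w="\<lambda>_. K * measure M (space M)"])
    show "AE \<omega> in M. (\<lambda>n. \<epsilon> \<omega> * (\<integral>\<omega>'. \<epsilon> \<omega>' * \<phi> (F n \<omega> - F n \<omega>') \<partial>M))
       \<longlonglongrightarrow> \<epsilon> \<omega> * (\<integral>\<omega>'. \<epsilon> \<omega>' * \<phi> (X \<omega> - X \<omega>') \<partial>M)"
    proof (intro AE_I2 tendsto_mult tendsto_const)
      fix \<omega> assume \<omega>: "\<omega> \<in> space M"
      show "(\<lambda>n. (\<integral>\<omega>'. \<epsilon> \<omega>' * \<phi> (F n \<omega> - F n \<omega>') \<partial>M)) \<longlonglongrightarrow> (\<integral>\<omega>'. \<epsilon> \<omega>' * \<phi> (X \<omega> - X \<omega>') \<partial>M)"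
        by (rule integral_dominated_convergence[where w="\<lambda>_. K"])
          (auto intro!: tendsto_intros lim F \<omega> abs_eps_mult_le bd)
    qed
  qed (auto intro!: abs_eps_mult_le abs_integral_eps_le bd)
  have "0 \<le> Ln n (\<lambda>x. Ln n (\<lambda>y. \<phi> (x - y))) + t * Ln n (\<lambda>x. \<phi> (x - x0)) + t * Ln n (\<lambda>y. \<phi> (x0 - y)) + t * t * \<phi> 0" for n
  proof -
    obtain xs where xs: "\<And>h. Ln n h = wsum xs h" unfolding Ln_def using L_simple_approx[OF F(1)] by metis
    have "0 \<le> wsum ((t, x0) # xs) (\<lambda>x. wsum ((t, x0) # xs) (\<lambda>y. \<phi> (x - y)))"
      using pd unfolding pos_def_fun_def by blast
    then show ?thesis by (simp add: xs wsum_add wsum_cmult algebra_simps)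
  qed
  moreover have "(\<lambda>n. Ln n (\<lambda>x. Ln n (\<lambda>y. \<phi> (x - y))) + t * Ln n (\<lambda>x. \<phi> (x - x0)) + t * Ln n (\<lambda>y. \<phi> (x0 - y)) + t * t * \<phi> 0)
     \<longlonglongrightarrow> L (\<lambda>x. L (\<lambda>y. \<phi> (x - y))) + t * L (\<lambda>x. \<phi> (x - x0)) + t * L (\<lambda>y. \<phi> (x0 - y)) + t * t * \<phi> 0"
    by (intro tendsto_intros l1 l2 l3)
  ultimately show ?thesis by (intro LIMSEQ_le_const) auto
qed

text \<open>The Cauchy--Schwarz argument: with zero energy,
  \<open>2 * t * b + t * t * \<phi> 0\<close> is nonnegative for every \<open>t\<close>, which
  forces the linear coefficient to vanish.\<close>

lemma pos_def_fun_integral_zero: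
  fixes \<phi> :: "'a \<Rightarrow> real"
  assumes pd: "pos_def_fun \<phi>" and cont: "continuous_on UNIV \<phi>" and bd: "\<And>z. \<bar>\<phi> z\<bar> \<le> K"
    and even: "\<And>z. \<phi> (- z) = \<phi> z" and zero: "L (\<lambda>x. L (\<lambda>y. \<phi> (x - y))) = 0"
  shows "L (\<lambda>y. \<phi> (x - y)) = 0"
proof -
  define b where "b = L (\<lambda>y. \<phi> (x - y))"
  \<comment> \<open>A strictly positive upper bound of \<open>\<phi> 0\<close>, so that
    \<open>t = - b / c\<close> makes sense even if \<open>\<phi> 0\<close> is 0.\<close>
  define c where "c = \<bar>\<phi> 0\<bar> + 1"
  have "L (\<lambda>y. \<phi> (y - x)) = b" using even[of "x - _"] by (simp add: b_def)
  then have *: "0 \<le> t * b + t * b + t * t * \<phi> 0" for t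
    using pos_def_fun_integral_nonneg[OF pd cont bd, of t x] zero by (simp add: b_def)
  have "c > 0" "\<phi> 0 \<le> c" by (auto simp: c_def)
  have "0 \<le> 2 * (- b / c) * b + (- b / c) * (- b / c) * \<phi> 0" using *[of "- b / c"] by simp
  also have "\<dots> \<le> 2 * (- b / c) * b + (- b / c) * (- b / c) * c"
    using \<open>\<phi> 0 \<le> c\<close> by (intro add_left_mono mult_left_mono) auto
  also have "\<dots> = - (b * b) / c" using \<open>c > 0\<close> by (simp add: field_simps)
  finally have "b * b \<le> 0" using \<open>c > 0\<close> by (simp add: field_simps)
  then have "b\<^sup>2 \<le> 0" by (simp add: power2_eq_square)
  then show ?thesis by (simp add: b_def)
qed

end

section \<open>Subordination of powers to Gaussians\<close>

text \<open>In closed form, \<open>exp_rem k x = (-1) ^ Suc k * (exp (- x) - (\<Sum>j\<le>k. (- x) ^ j / fact j))\<close>.\<close>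

fun exp_rem :: "nat \<Rightarrow> real \<Rightarrow> real" where
  "exp_rem 0 x = 1 - exp (- x)"
| "exp_rem (Suc k) x = x ^ Suc k / fact (Suc k) - exp_rem k x"

lemma exp_rem_deriv: "(exp_rem (Suc k) has_real_derivative exp_rem k x) (at x)"
proof (induction k)
  case 0
  show ?case by (auto intro!: derivative_eq_intros simp: fun_eq_iff)
next
  case (Suc k)
  have "((\<lambda>x::real. x ^ Suc (Suc k) / fact (Suc (Suc k))) has_real_derivative x ^ Suc k / fact (Suc k)) (at x)"
    by (rule DERIV_cong[OF DERIV_cdivide[OF DERIV_pow]])
      (simp add: fact_Suc[of "Suc k"] del: fact_Suc power_Suc of_nat_Suc)
  from DERIV_diff[OF this Suc]
  have "((\<lambda>x. x ^ Suc (Suc k) / fact (Suc (Suc k)) - exp_rem (Suc k) x) has_real_derivative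
     (x ^ Suc k / fact (Suc k) - exp_rem k x)) (at x)"
    .
  then show ?case by (simp only: exp_rem.simps(2)[abs_def])
qed

lemma exp_rem_at_0 [simp]: "exp_rem k 0 = 0"
  by (induction k) auto

text \<open>Each remainder vanishes at 0 and has the previous remainder as its derivative, so
  nonnegativity passes up by monotonicity.\<close>

lemma exp_rem_nonneg: "x \<ge> 0 \<Longrightarrow> exp_rem k x \<ge> 0"
proof (induction k arbitrary: x)
  case (Suc k)
  have "exp_rem (Suc k) 0 \<le> exp_rem (Suc k) x"
  proof (rule DERIV_nonneg_imp_nondecreasing[OF Suc.prems])
    fix y :: real assume "0 \<le> y"
    with Suc.IH show "\<exists>d. (exp_rem (Suc k) has_real_derivative d) (at y) \<and> 0 \<le> d"
      using exp_rem_deriv by blast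
  qed
  then show ?case by simp
qed simp

text \<open>Nonnegativity of the next remainder; this bound is used near 0.\<close>

lemma exp_rem_le_Suc: "x \<ge> 0 \<Longrightarrow> exp_rem k x \<le> x ^ Suc k"
proof -
  assume x: "x \<ge> 0"
  have "exp_rem k x \<le> x ^ Suc k / fact (Suc k)" using exp_rem_nonneg[OF x, of "Suc k"] by simp
  also have "\<dots> \<le> x ^ Suc k / 1"
    by (intro divide_left_mono fact_ge_1 zero_le_power x) auto
  finally show ?thesis by simp
qed

text \<open>Nonnegativity of the previous remainder; this bound is used near infinity.\<close>

lemma exp_rem_le: "x \<ge> 0 \<Longrightarrow> exp_rem k x \<le> x ^ k"
proof (cases k)
  case (Suc j)
  assume x: "x \<ge> 0"
  have "exp_rem k x \<le> x ^ k / fact k" using exp_rem_nonneg[OF x, of j] Suc by simp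
  also have "\<dots> \<le> x ^ k / 1"
    by (intro divide_left_mono fact_ge_1 zero_le_power x) auto
  finally show ?thesis by simp
qed simp

lemma exp_rem_measurable [measurable]: "exp_rem k \<in> borel_measurable borel"
proof (induction k)
  case 0
  then show ?case by (simp add: exp_rem.simps(1)[abs_def])
next
  case (Suc k)
  then have [measurable]: "exp_rem k \<in> borel_measurable borel" .
  show ?case by (simp only: exp_rem.simps(2)[abs_def]) measurable
qed

text \<open>For \<open>k < q < k + 1\<close> the integral of \<open>subord k q s a\<close> over \<open>s\<close> is a multiple of \<open>a powr q\<close>; the
  Taylor terms removed in \<open>exp_rem\<close> are what makes it converge at \<open>s = 0\<close>.\<close>

definition subord :: "nat \<Rightarrow> real \<Rightarrow> real \<Rightarrow> real \<Rightarrow> real" where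
  "subord k q s a = indicator {0<..} s * (exp_rem k (s * a) * s powr (- 1 - q))"

lemma subord_nonneg: "a \<ge> 0 \<Longrightarrow> subord k q s a \<ge> 0"
  by (auto simp: subord_def indicator_def exp_rem_nonneg)

lemma subord_measurable [measurable]:
  assumes [measurable]: "f \<in> borel_measurable N" "g \<in> borel_measurable N"
  shows "(\<lambda>x. subord k q (f x) (g x)) \<in> borel_measurable N"
  unfolding subord_def by measurable

definition subord_const :: "nat \<Rightarrow> real \<Rightarrow> real" where
  "subord_const k q = enn2real (\<integral>\<^sup>+ s. ennreal (subord k q s 1) \<partial>lborel)"

text \<open>The integrand is at most \<open>s powr (k - q)\<close> on the unit interval and
  \<open>s powr (k - 1 - q)\<close> beyond it. These converge precisely because
  \<open>q < k + 1\<close> and \<open>k < q\<close> respectively.\<close>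

lemma nn_integral_subord_finite:
  assumes "real k < q" "q < real k + 1"
  shows "(\<integral>\<^sup>+ s. ennreal (subord k q s 1) \<partial>lborel) < \<infinity>"
proof -
  have 1: "(\<integral>\<^sup>+ s. indicator {0..1} s * ennreal (s powr (real k - q)) \<partial>lborel) < \<infinity>"
  proof -
    have "((\<lambda>s. if s \<in> {0..1} then s powr (real k - q) else 0) has_integral (1 / (real k - q + 1))) UNIV"
      unfolding has_integral_restrict_UNIV using has_integral_powr_from_0[of "real k - q" 1] assms by simp
    then have "(\<integral>\<^sup>+ s. ennreal (if s \<in> {0..1} then s powr (real k - q) else 0) \<partial>lborel) = ennreal (1 / (real k - q + 1))"
      by (intro nn_integral_has_integral_lborel) auto
    also have "(\<lambda>s. ennreal (if s \<in> {0..1} then s powr (real k - q) else 0)) = (\<lambda>s. indicator {0..1} s * ennreal (s powr (real k - q)))"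
      by (auto simp: fun_eq_iff indicator_def)
    finally show ?thesis by simp
  qed
  have 2: "(\<integral>\<^sup>+ s. indicator {1..} s * ennreal (s powr (real k - 1 - q)) \<partial>lborel) < \<infinity>"
  proof -
    have "((\<lambda>s. if s \<in> {1..} then s powr (real k - 1 - q) else 0) has_integral (- 1 / (real k - 1 - q + 1))) UNIV"
      unfolding has_integral_restrict_UNIV using has_integral_powr_to_inf[of "real k - 1 - q" 1] assms by simp
    then have "(\<integral>\<^sup>+ s. ennreal (if s \<in> {1..} then s powr (real k - 1 - q) else 0) \<partial>lborel) = ennreal (- 1 / (real k - 1 - q + 1))"
      by (intro nn_integral_has_integral_lborel) auto
    also have "(\<lambda>s. ennreal (if s \<in> {1..} then s powr (real k - 1 - q) else 0)) = (\<lambda>s. indicator {1..} s * ennreal (s powr (real k - 1 - q)))"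
      by (auto simp: fun_eq_iff indicator_def)
    finally show ?thesis by simp
  qed
  have "(\<integral>\<^sup>+ s. ennreal (subord k q s 1) \<partial>lborel) \<le>
     (\<integral>\<^sup>+ s. indicator {0..1} s * ennreal (s powr (real k - q)) + indicator {1..} s * ennreal (s powr (real k - 1 - q)) \<partial>lborel)"
  proof (intro nn_integral_mono)
    fix s :: real
    show "ennreal (subord k q s 1) \<le> indicator {0..1} s * ennreal (s powr (real k - q)) + indicator {1..} s * ennreal (s powr (real k - 1 - q))"
    proof (cases "s > 0")
      case True
      have p: "s ^ k * s powr (- 1 - q) = s powr (real k - 1 - q)" "s ^ Suc k * s powr (- 1 - q) = s powr (real k - q)"
        using True by (simp_all add: powr_realpow[symmetric] powr_add[symmetric] algebra_simps del: power_Suc)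
      show ?thesis
      proof (cases "s \<le> 1")
        case le: True
        have "subord k q s 1 \<le> s powr (real k - q)"
          using True exp_rem_le_Suc[of s k] p(2)[symmetric] by (simp add: subord_def mult_right_mono del: power_Suc)
        then show ?thesis using True le by (intro add_increasing2) (auto intro!: ennreal_leI)
      next
        case False
        have "subord k q s 1 \<le> s powr (real k - 1 - q)"
          using True exp_rem_le[of s k] p(1)[symmetric] by (simp add: subord_def mult_right_mono)
        then show ?thesis using False by (intro add_increasing) (auto intro!: ennreal_leI)
      qed
    qed (simp add: subord_def)
  qed
  also have "\<dots> < \<infinity>" using 1 2 by (subst nn_integral_add) auto
  finally show ?thesis .
qed

text \<open>Homogeneity: substituting \<open>a * s\<close> for \<open>s\<close> in the integral that
  defines the constant pulls out the power of \<open>a\<close>.\<close>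

lemma nn_integral_subord:
  assumes q: "real k < q" "q < real k + 1" and a: "a \<ge> 0"
  shows "(\<integral>\<^sup>+ s. ennreal (subord k q s a) \<partial>lborel) = ennreal (subord_const k q * a powr q)"
proof (cases "a = 0")
  case False
  with a have "a > 0" by simp
  let ?I = "\<integral>\<^sup>+ s. ennreal (subord k q s 1) \<partial>lborel"
  have sc: "subord k q (a * s) 1 = a powr (- 1 - q) * subord k q s a" for s
    using \<open>a > 0\<close> by (auto simp: subord_def indicator_def powr_mult zero_less_mult_iff mult_ac)
  have "?I = ennreal a * (\<integral>\<^sup>+ s. ennreal (subord k q (a * s) 1) \<partial>lborel)"
    using nn_integral_real_affine[of "\<lambda>s. ennreal (subord k q s 1)" a 0] \<open>a > 0\<close> by simp
  also have "\<dots> = ennreal a * (ennreal (a powr (- 1 - q)) * (\<integral>\<^sup>+ s. ennreal (subord k q s a) \<partial>lborel))"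
    using \<open>a > 0\<close> by (simp add: sc ennreal_mult' nn_integral_cmult)
  also have "\<dots> = ennreal (a powr (- q)) * (\<integral>\<^sup>+ s. ennreal (subord k q s a) \<partial>lborel)"
    using \<open>a > 0\<close> powr_add[of a 1 "- 1 - q"] by (simp add: mult.assoc[symmetric] ennreal_mult'[symmetric])
  finally have "ennreal (a powr q) * ?I = ennreal (a powr q * a powr (- q)) * (\<integral>\<^sup>+ s. ennreal (subord k q s a) \<partial>lborel)"
    by (simp add: ennreal_mult' mult.assoc)
  also have "a powr q * a powr (- q) = 1" using \<open>a > 0\<close> by (simp add: powr_add[symmetric])
  finally have "(\<integral>\<^sup>+ s. ennreal (subord k q s a) \<partial>lborel) = ennreal (a powr q) * ?I" by simp
  also have "?I = ennreal (subord_const k q)"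
    using nn_integral_subord_finite[OF q] by (simp add: subord_const_def)
  finally show ?thesis by (simp add: ennreal_mult' mult.commute subord_const_def)
qed (simp add: subord_def)

section \<open>Gaussian energies\<close>

lemma powr_add3_le:
  fixes a b c :: real
  assumes "a \<ge> 0" "b \<ge> 0" "c \<ge> 0" "p \<ge> 0"
  shows "(a + b + c) powr p \<le> 3 powr p * (a powr p + b powr p + c powr p)"
proof -
  define m where "m = max a (max b c)"
  have "(a + b + c) powr p \<le> (3 * m) powr p"
    using assms by (intro powr_mono2) (auto simp: m_def)
  also have "\<dots> = 3 powr p * m powr p" using assms by (simp add: powr_mult m_def)
  also have "m powr p \<le> a powr p + b powr p + c powr p"
    by (auto simp: m_def max_def intro: add_increasing add_increasing2)
  finally show ?thesis by (simp add: mult_left_mono)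
qed

lemma norm_powr_add3_le:
  fixes x y w :: "'a::real_normed_vector"
  assumes "p \<ge> 0"
  shows "norm (x - y + w) powr p \<le> 3 powr p * (norm x powr p + norm y powr p + norm w powr p)"
proof -
  have "norm (x - y + w) \<le> norm x + norm y + norm w"
    using norm_triangle_ineq[of "x - y" w] norm_triangle_ineq4[of x y] by linarith
  then have "norm (x - y + w) powr p \<le> (norm x + norm y + norm w) powr p"
    using assms by (intro powr_mono2) auto
  also have "\<dots> \<le> 3 powr p * (norm x powr p + norm y powr p + norm w powr p)"
    using assms by (intro powr_add3_le) auto
  finally show ?thesis .
qed

lemma integrable_norm_diff_powr:
  fixes N :: "'a::{real_normed_vector, second_countable_topology} measure"
  assumes "prob_space N" and [measurable_cong]: "sets N = sets borel"
    and N: "integrable N (\<lambda>x. norm x powr p)" and p: "p \<ge> 0"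
  shows "integrable N (\<lambda>y. norm (y - x) powr p)"
proof (rule Bochner_Integration.integrable_bound)
  interpret N: prob_space N by fact
  show "integrable N (\<lambda>y. 3 powr p * (norm y powr p + norm x powr p + norm (0::'a) powr p))"
    using N by simp
  show "AE y in N. norm (norm (y - x) powr p) \<le> norm (3 powr p * (norm y powr p + norm x powr p + norm (0::'a) powr p))"
    using norm_powr_add3_le[of p _ x 0] p by (intro AE_I2) (auto intro: order_trans[OF _ abs_ge_self])
qed measurable

abbreviation gauss :: "real \<Rightarrow> 'a::real_inner \<Rightarrow> real" where
  "gauss s z \<equiv> exp (- (s * (norm z)\<^sup>2))"

lemma gauss_translate_tendsto_0:
  assumes "s > 0" "u \<noteq> 0"
  shows "(\<lambda>n. gauss s (z + real n *\<^sub>R u)) \<longlonglongrightarrow> 0"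
proof -
  have "filterlim (\<lambda>n. - norm z + norm u * real n) at_top sequentially"
    using assms by (intro filterlim_tendsto_add_at_top[OF tendsto_const]
        filterlim_tendsto_pos_mult_at_top[OF tendsto_const] filterlim_real_sequentially) auto
  then have "filterlim (\<lambda>n. norm (z + real n *\<^sub>R u)) at_top sequentially"
  proof (rule filterlim_at_top_mono)
    show "\<forall>\<^sub>F n in sequentially. - norm z + norm u * real n \<le> norm (z + real n *\<^sub>R u)"
    proof (intro always_eventually allI)
      fix n
      show "- norm z + norm u * real n \<le> norm (z + real n *\<^sub>R u)"
        using norm_triangle_ineq2[of "real n *\<^sub>R u" "- z"] by (simp add: add.commute mult.commute)
    qed
  qed
  then have "filterlim (\<lambda>n. s * (norm (z + real n *\<^sub>R u))\<^sup>2) at_top sequentially"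
    using assms by (intro filterlim_tendsto_pos_mult_at_top[OF tendsto_const] filterlim_pow_at_top) auto
  then show ?thesis
    by (intro filterlim_compose[OF exp_at_bot]) (simp add: filterlim_uminus_at_top[symmetric])
qed

lemma sec_diff_iter_even:
  assumes "\<And>z. f (- z) = f z" shows "(sec_diff u ^^ k) f (- z) = (sec_diff u ^^ k) f z"
proof (induction k arbitrary: z)
  case (Suc k)
  have "(sec_diff u ^^ k) f (- z + u) = (sec_diff u ^^ k) f (z - u)"
    "(sec_diff u ^^ k) f (- z - u) = (sec_diff u ^^ k) f (z + u)"
    using Suc[of "z - u"] Suc[of "z + u"] by simp_all
  then show ?case by (simp add: sec_diff_def[of u "(sec_diff u ^^ k) f"] Suc)
qed (simp add: assms)

text \<open>\<open>exp_rem k\<close> differs from a signed exponential by its Taylor polynomial,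
  which has degree at most \<open>2 * k\<close> in \<open>z\<close>; \<open>k\<close> second
  differences leave only a constant of it.\<close>

lemma sec_diff_iter_exp_rem:
  obtains \<kappa> where "\<And>z::'a::real_inner. (sec_diff u ^^ k) (\<lambda>z. exp_rem k (s * (norm z)\<^sup>2)) z =
      (-1) ^ Suc k * (sec_diff u ^^ k) (gauss s) z + \<kappa>"
proof -
  define P :: "nat \<Rightarrow> 'a \<Rightarrow> real" where
    "P k z = exp_rem k (s * (norm z)\<^sup>2) - (-1) ^ Suc k * gauss s z" for k z
  have "frechet_poly (2 * k) (P k)"
  proof (induction k)
    case 0
    have "P 0 = (\<lambda>_. 1)" by (simp add: P_def fun_eq_iff)
    then show ?case by (simp only: frechet_poly_const)
  next
    case (Suc k)
    have eq: "P (Suc k) = (\<lambda>z. (s ^ Suc k / fact (Suc k)) * ((norm z)\<^sup>2) ^ Suc k + (-1) * P k z)"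
      by (simp add: P_def fun_eq_iff power_mult_distrib)
    show ?case unfolding eq
      by (intro frechet_poly_add frechet_poly_cmult frechet_poly_norm_power
          frechet_poly_mono[OF _ Suc]) simp
  qed
  then have 0: "frechet_poly 0 ((sec_diff u ^^ k) (P k))" by (rule frechet_poly_sec_diff_iter)
  obtain n :: nat and c :: "nat \<Rightarrow> real" and w :: "nat \<Rightarrow> 'a"
    where repr: "\<And>f z. (sec_diff u ^^ k) f z = (\<Sum>i<n. c i * f (z + w i))"
    using sec_diff_iter_repr[of k u] by blast
  have "(sec_diff u ^^ k) (\<lambda>z. exp_rem k (s * (norm z)\<^sup>2)) z =
      (-1) ^ Suc k * (sec_diff u ^^ k) (gauss s) z + (sec_diff u ^^ k) (P k) z" for z
    unfolding repr P_def sum_distrib_left sum.distrib[symmetric]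
    by (intro sum.cong refl) (simp add: algebra_simps)
  also have "(sec_diff u ^^ k) (P k) z = (sec_diff u ^^ k) (P k) 0" for z
    using frechet_poly_0_eq[OF 0] .
  finally show thesis by (rule that)
qed

context signed_functional
begin

text \<open>Zero energy makes the \<open>k\<close>-fold second difference of the Gaussian potential
  \<open>m\<close> vanish. Since \<open>m\<close> tends to 0 along multiples of \<open>u\<close>, it
  vanishes itself.\<close>

lemma L_gauss_zero_if_energy_zero:
  assumes s: "s > 0" and u: "u \<noteq> 0"
    and zero: "L (\<lambda>x. L (\<lambda>y. (sec_diff u ^^ k) (gauss s) (x - y))) = 0"
  shows "L (\<lambda>y. gauss s (x - y)) = 0"
proof -
  obtain n :: nat and c :: "nat \<Rightarrow> real" and w :: "nat \<Rightarrow> 'a"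
    where repr: "\<And>f z. (sec_diff u ^^ k) f z = (\<Sum>i<n. c i * f (z + w i))"
    using sec_diff_iter_repr[of k u] by blast
  define m where "m x = L (\<lambda>y. gauss s (x - y))" for x
  have int: "integrable M (\<lambda>\<omega>. \<epsilon> \<omega> * gauss s (x - X \<omega>))" for x
    using s by (intro integrable_L[of "\<lambda>y. gauss s (x - y)" 1]) auto
  have Um: "(sec_diff u ^^ k) m x = L (\<lambda>y. (sec_diff u ^^ k) (gauss s) (x - y))" for x
  proof -
    have "L (\<lambda>y. (sec_diff u ^^ k) (gauss s) (x - y)) =
        (\<integral>\<omega>. (\<Sum>i<n. c i * (\<epsilon> \<omega> * gauss s (x + w i - X \<omega>))) \<partial>M)"
      unfolding L_def repr by (simp add: sum_distrib_left algebra_simps)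
    also have "\<dots> = (\<Sum>i<n. c i * m (x + w i))"
      unfolding m_def L_def using int by (subst Bochner_Integration.integral_sum) auto
    finally show ?thesis by (simp add: repr)
  qed
  have "(sec_diff u ^^ k) m x = 0" for x unfolding Um
  proof (rule pos_def_fun_integral_zero[where K="\<Sum>i<n. \<bar>c i\<bar>"])
    show "pos_def_fun ((sec_diff u ^^ k) (gauss s))"
      using s by (intro pos_def_fun_sec_diff_iter pos_def_fun_gaussian) auto
    show "continuous_on UNIV ((sec_diff u ^^ k) (gauss s))"
      unfolding repr[abs_def] by (intro continuous_intros)
    show "\<bar>(sec_diff u ^^ k) (gauss s) z\<bar> \<le> (\<Sum>i<n. \<bar>c i\<bar>)" for z
      unfolding repr using s by (intro order_trans[OF sum_abs] sum_mono) (auto simp: abs_mult mult_left_le)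
    show "(sec_diff u ^^ k) (gauss s) (- z) = (sec_diff u ^^ k) (gauss s) z" for z
      by (rule sec_diff_iter_even) simp
  qed (rule zero)
  moreover have "(\<lambda>n. m (z + real n *\<^sub>R u)) \<longlonglongrightarrow> 0" for z
  proof -
    have "(\<lambda>n. m (z + real n *\<^sub>R u)) \<longlonglongrightarrow> (\<integral>\<omega>. 0 \<partial>M)" unfolding m_def L_def
    proof (rule integral_dominated_convergence[where w="\<lambda>_. 1"])
      show "AE \<omega> in M. (\<lambda>n. \<epsilon> \<omega> * gauss s (z + real n *\<^sub>R u - X \<omega>)) \<longlonglongrightarrow> 0"
        using gauss_translate_tendsto_0[OF s u, of "z - X _"]
        by (intro AE_I2 tendsto_mult_right_zero) (simp add: algebra_simps)
    qed (use s in \<open>auto intro!: abs_eps_mult_le\<close>)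
    then show ?thesis by simp
  qed
  ultimately have "m x = 0" by (intro sec_diff_iter_decay_zero[of m u k])
  then show ?thesis by (simp add: m_def)
qed

text \<open>The value depends continuously on \<open>s\<close>, and a nonempty open set of
  exceptional \<open>s\<close> would not be negligible.\<close>

lemma L_gauss_zero_if_AE:
  assumes "AE s in lborel. s > 0 \<longrightarrow> L (\<lambda>y. gauss s (x - y)) = 0" and "s > 0"
  shows "L (\<lambda>y. gauss s (x - y)) = 0"
proof (rule ccontr)
  assume neq: "L (\<lambda>y. gauss s (x - y)) \<noteq> 0"
  define h where "h s = L (\<lambda>y. gauss s (x - y))" for s
  have "continuous_on {0<..} h"
  proof (rule continuous_on_sequentiallyI)
    fix f :: "nat \<Rightarrow> real" and a
    assume f: "\<forall>n. f n \<in> {0<..}" "f \<longlonglongrightarrow> a"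
    show "(\<lambda>n. h (f n)) \<longlonglongrightarrow> h a" unfolding h_def L_def
      by (rule integral_dominated_convergence[where w="\<lambda>_. 1"])
        (use f in \<open>auto intro!: AE_I2 abs_eps_mult_le tendsto_intros mult_nonneg_nonneg simp: less_imp_le\<close>)
  qed
  then have op: "open ({0<..} \<inter> h -` (- {0}))"
    by (intro continuous_open_preimage) auto
  moreover have "{0<..} \<inter> h -` (- {0}) \<noteq> {}" using neq \<open>s > 0\<close> by (auto simp: h_def)
  ultimately have "\<not> negligible ({0<..} \<inter> h -` (- {0}))" by (rule open_not_negligible)
  moreover have "{0<..} \<inter> h -` (- {0}) \<in> null_sets lborel"
    using assms(1) op by (subst AE_iff_null_sets) (auto simp: h_def elim!: eventually_mono)
  then have "negligible ({0<..} \<inter> h -` (- {0}))"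
    by (simp add: negligible_iff_null_sets null_sets_completionI)
  ultimately show False by blast
qed

text \<open>The subordination formula, differenced \<open>k\<close> times, is integrated against the
  square of the signed measure. Exchanging the integrals shows that the energies, which have one
  sign, integrate to 0 over \<open>s\<close>.\<close>

lemma energy_AE_zero:
  fixes p q :: real and u :: 'a
  assumes q: "real k < q" "q < real k + 1" and p: "p = 2 * q"
    and int: "integrable M (\<lambda>\<omega>. norm (X \<omega>) powr p)"
    and pot: "\<And>x. L (\<lambda>y. norm (y - x) powr p) = 0"
  shows "AE s in lborel. s > 0 \<longrightarrow> L (\<lambda>x. L (\<lambda>y. (sec_diff u ^^ k) (gauss s) (x - y))) = 0"
proof -
  have "q > 0" "p > 0" using q p by auto
  obtain n :: nat and c :: "nat \<Rightarrow> real" and w :: "nat \<Rightarrow> 'a"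
    where repr: "\<And>f z. (sec_diff u ^^ k) f z = (\<Sum>i<n. c i * f (z + w i))"
    using sec_diff_iter_repr[of k u] by blast
  let ?MM = "M \<Otimes>\<^sub>M M"
  interpret P: pair_sigma_finite M M ..
  interpret PF: finite_measure ?MM by (rule finite_measure_pair_measure) unfold_locales
  interpret Q: pair_sigma_finite ?MM lborel ..
  \<comment> \<open>On two independent copies, \<open>Z\<close> is the difference of the points and
    \<open>E\<close> the product of the densities.\<close>
  define Z where "Z \<zeta> = X (fst \<zeta>) - X (snd \<zeta>)" for \<zeta>
  define E where "E \<zeta> = \<epsilon> (fst \<zeta>) * \<epsilon> (snd \<zeta>)" for \<zeta>
  have [measurable]: "Z \<in> borel_measurable ?MM" "E \<in> borel_measurable ?MM"
    unfolding Z_def E_def by measurable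
  have E1: "\<bar>E \<zeta>\<bar> \<le> 1" for \<zeta>
    unfolding E_def using abs_eps_mult_le eps_bounded by blast
  have fub: "(\<integral>\<zeta>. E \<zeta> * f (Z \<zeta>) \<partial>?MM) = L (\<lambda>x. L (\<lambda>y. f (x - y)))"
    if "integrable ?MM (\<lambda>\<zeta>. E \<zeta> * f (Z \<zeta>))" for f
    using P.integral_fst'[OF that] by (simp add: E_def Z_def L_def mult.assoc)

  have int_fst: "integrable ?MM (\<lambda>\<zeta>. norm (X (fst \<zeta>)) powr p)"
    using int by (intro P.Fubini_integrable) auto
  have int_snd: "integrable ?MM (\<lambda>\<zeta>. norm (X (snd \<zeta>)) powr p)"
    using int by (intro P.Fubini_integrable) auto
  have int_Z: "integrable ?MM (\<lambda>\<zeta>. norm (Z \<zeta> + v) powr p)" for v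
  proof (rule Bochner_Integration.integrable_bound)
    show "integrable ?MM (\<lambda>\<zeta>. 3 powr p * (norm (X (fst \<zeta>)) powr p + norm (X (snd \<zeta>)) powr p + norm v powr p))"
      using int_fst int_snd by simp
    show "AE \<zeta> in ?MM. norm (norm (Z \<zeta> + v) powr p) \<le>
        norm (3 powr p * (norm (X (fst \<zeta>)) powr p + norm (X (snd \<zeta>)) powr p + norm v powr p))"
      using norm_powr_add3_le[of p] \<open>p > 0\<close> by (intro AE_I2) (auto simp: Z_def intro: order_trans[OF _ abs_ge_self])
  qed measurable
  have int_EZ: "integrable ?MM (\<lambda>\<zeta>. E \<zeta> * norm (Z \<zeta> + v) powr p)" for v
    using E1 by (intro Bochner_Integration.integrable_bound[OF int_Z[of v]])
      (auto simp: abs_mult intro!: mult_left_le_one_le)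
  \<comment> \<open>For fixed \<open>x\<close> the inner integral is the potential at
    \<open>x + v\<close>.\<close>
  have zero_Z: "(\<integral>\<zeta>. E \<zeta> * norm (Z \<zeta> + v) powr p \<partial>?MM) = 0" for v
  proof -
    have "L (\<lambda>y. norm (x - y + v) powr p) = 0" for x
      using pot[of "x + v"] by (simp add: norm_minus_commute algebra_simps)
    then show ?thesis by (subst fub[OF int_EZ]) (simp add: L_def)
  qed

  define C where "C = subord_const k q"
  have sub: "(\<integral>\<^sup>+ s. ennreal (subord k q s ((norm z)\<^sup>2)) \<partial>lborel) = ennreal (C * norm z powr p)" for z :: 'a
  proof -
    have "((norm z)\<^sup>2) powr q = norm z powr p"
      by (cases "z = 0") (simp_all add: p powr_powr powr_numeral[symmetric] del: powr_numeral)
    then show ?thesis using nn_integral_subord[OF q, of "(norm z)\<^sup>2"] by (simp add: C_def)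
  qed
  have "C \<ge> 0" by (simp add: C_def subord_const_def)
  define H where "H v \<zeta> s = E \<zeta> * subord k q s ((norm (Z \<zeta> + v))\<^sup>2)" for v \<zeta> s
  \<comment> \<open>The integrand is nonnegative, so Tonelli and the subordination formula give its
    integral. As \<open>E\<close> is bounded by 1, this dominates \<open>H\<close> and justifies the
    exchange of integrals.\<close>
  have int_sub: "integrable (?MM \<Otimes>\<^sub>M lborel) (\<lambda>(\<zeta>, s). subord k q s ((norm (Z \<zeta> + v))\<^sup>2))" for v
  proof (rule integrableI_bounded)
    have "(\<integral>\<^sup>+ \<xi>. ennreal (norm (case \<xi> of (\<zeta>, s) \<Rightarrow> subord k q s ((norm (Z \<zeta> + v))\<^sup>2))) \<partial>(?MM \<Otimes>\<^sub>M lborel)) =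
       (\<integral>\<^sup>+ \<zeta>. (\<integral>\<^sup>+ s. ennreal (subord k q s ((norm (Z \<zeta> + v))\<^sup>2)) \<partial>lborel) \<partial>?MM)"
      by (subst lborel.nn_integral_fst[symmetric]) (auto simp: subord_nonneg)
    also have "\<dots> = (\<integral>\<^sup>+ \<zeta>. ennreal (C * norm (Z \<zeta> + v) powr p) \<partial>?MM)" by (simp add: sub)
    also have "\<dots> < \<infinity>"
      using int_Z[of v] \<open>C \<ge> 0\<close> by (subst nn_integral_eq_integral) auto
    finally show "(\<integral>\<^sup>+ \<xi>. ennreal (norm (case \<xi> of (\<zeta>, s) \<Rightarrow> subord k q s ((norm (Z \<zeta> + v))\<^sup>2))) \<partial>(?MM \<Otimes>\<^sub>M lborel)) < \<infinity>" .
  qed measurable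
  have int_H: "integrable (?MM \<Otimes>\<^sub>M lborel) (\<lambda>(\<zeta>, s). H v \<zeta> s)" for v
    using E1 by (intro Bochner_Integration.integrable_bound[OF int_sub[of v]])
      (auto simp: H_def abs_mult subord_nonneg intro!: AE_I2 mult_left_le_one_le)
  have H_s: "(\<integral>s. H v \<zeta> s \<partial>lborel) = E \<zeta> * (C * norm (Z \<zeta> + v) powr p)" for v \<zeta>
  proof -
    have "(\<integral>s. subord k q s ((norm (Z \<zeta> + v))\<^sup>2) \<partial>lborel) = C * norm (Z \<zeta> + v) powr p"
      using sub[of "Z \<zeta> + v"] \<open>C \<ge> 0\<close> by (subst integral_eq_nn_integral) (auto simp: subord_nonneg)
    then show ?thesis by (simp add: H_def)
  qed
  \<comment> \<open>\<open>E\<close> times the \<open>k\<close>-fold second difference of the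
    subordinated kernel, evaluated at \<open>Z\<close>.\<close>
  define F where "F \<zeta> s = (\<Sum>i<n. c i * H (w i) \<zeta> s)" for \<zeta> s
  have int_F: "integrable (?MM \<Otimes>\<^sub>M lborel) (\<lambda>(\<zeta>, s). F \<zeta> s)"
    using int_H unfolding F_def split_def by (intro Bochner_Integration.integrable_sum) auto
  have H_zero: "(\<integral>\<xi>. (case \<xi> of (\<zeta>, s) \<Rightarrow> H v \<zeta> s) \<partial>(?MM \<Otimes>\<^sub>M lborel)) = 0" for v
    using Q.integral_fst'[OF int_H[of v]] zero_Z[of v] by (simp add: H_s mult.left_commute)
  have "(\<integral>s. (\<integral>\<zeta>. F \<zeta> s \<partial>?MM) \<partial>lborel) = (\<integral>\<xi>. (case \<xi> of (\<zeta>, s) \<Rightarrow> F \<zeta> s) \<partial>(?MM \<Otimes>\<^sub>M lborel))"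
    using Q.integral_snd[OF int_F] by simp
  also have "\<dots> = (\<Sum>i<n. c i * (\<integral>\<xi>. (case \<xi> of (\<zeta>, s) \<Rightarrow> H (w i) \<zeta> s) \<partial>(?MM \<Otimes>\<^sub>M lborel)))"
    unfolding F_def split_def using int_H
    by (subst Bochner_Integration.integral_sum) (auto simp: split_def)
  also have "\<dots> = 0" by (simp add: H_zero)
  finally have F_zero: "(\<integral>s. (\<integral>\<zeta>. F \<zeta> s \<partial>?MM) \<partial>lborel) = 0" .
  have F_int: "integrable lborel (\<lambda>s. \<integral>\<zeta>. F \<zeta> s \<partial>?MM)"
    using Q.integrable_snd[OF int_F] .

  define B where "B s = L (\<lambda>x. L (\<lambda>y. (sec_diff u ^^ k) (gauss s) (x - y)))" for s
  have B_nonneg: "B s \<ge> 0" if s: "s > 0" for s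
  proof -
    have "0 \<le> L (\<lambda>x. L (\<lambda>y. (sec_diff u ^^ k) (gauss s) (x - y)))
       + 0 * L (\<lambda>x. (sec_diff u ^^ k) (gauss s) (x - 0)) + 0 * L (\<lambda>y. (sec_diff u ^^ k) (gauss s) (0 - y))
       + 0 * 0 * (sec_diff u ^^ k) (gauss s) 0"
    proof (rule pos_def_fun_integral_nonneg[where K="\<Sum>i<n. \<bar>c i\<bar>"])
      show "pos_def_fun ((sec_diff u ^^ k) (gauss s))"
        using s by (intro pos_def_fun_sec_diff_iter pos_def_fun_gaussian) auto
      show "continuous_on UNIV ((sec_diff u ^^ k) (gauss s))"
        unfolding repr[abs_def] by (intro continuous_intros)
      show "\<bar>(sec_diff u ^^ k) (gauss s) z\<bar> \<le> (\<Sum>i<n. \<bar>c i\<bar>)" for z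
        unfolding repr using s by (intro order_trans[OF sum_abs] sum_mono) (auto simp: abs_mult mult_left_le)
    qed
    then show ?thesis by (simp add: B_def)
  qed
  have FB: "(\<integral>\<zeta>. F \<zeta> s \<partial>?MM) = (-1) ^ Suc k * (indicator {0<..} s * s powr (- 1 - q) * B s)" for s
  proof (cases "s > 0")
    case s: True
    obtain \<kappa> where \<kappa>: "\<And>z::'a. (sec_diff u ^^ k) (\<lambda>z. exp_rem k (s * (norm z)\<^sup>2)) z =
      (-1) ^ Suc k * (sec_diff u ^^ k) (gauss s) z + \<kappa>"
      using sec_diff_iter_exp_rem by blast
    have F_eq: "F \<zeta> s = s powr (- 1 - q) * ((-1) ^ Suc k * (E \<zeta> * (sec_diff u ^^ k) (gauss s) (Z \<zeta>)) + \<kappa> * E \<zeta>)" for \<zeta>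
    proof -
      have "F \<zeta> s = s powr (- 1 - q) * (E \<zeta> * (sec_diff u ^^ k) (\<lambda>z. exp_rem k (s * (norm z)\<^sup>2)) (Z \<zeta>))"
        unfolding F_def H_def repr sum_distrib_left using s
        by (intro sum.cong refl) (simp add: subord_def)
      then show ?thesis unfolding \<kappa> by (simp add: algebra_simps)
    qed
    have i1: "integrable ?MM E"
      using E1 by (intro PF.integrable_const_bound[of _ 1]) auto
    have i2: "integrable ?MM (\<lambda>\<zeta>. E \<zeta> * (sec_diff u ^^ k) (gauss s) (Z \<zeta>))"
    proof -
      have "integrable ?MM (\<lambda>\<zeta>. E \<zeta> * gauss s (Z \<zeta> + v))" for v
        using s E1 by (intro PF.integrable_const_bound[of _ 1]) (auto simp: abs_mult intro!: AE_I2 mult_le_one)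
      then have "integrable ?MM (\<lambda>\<zeta>. \<Sum>i<n. c i * (E \<zeta> * gauss s (Z \<zeta> + w i)))" by auto
      then show ?thesis by (simp add: repr sum_distrib_left mult.left_commute)
    qed
    \<comment> \<open>Total mass zero is what eliminates the constant
      \<open>\<kappa>\<close>.\<close>
    have "(\<integral>\<zeta>. E \<zeta> \<partial>?MM) = 0"
      using fub[of "\<lambda>_. 1"] i1 eps_balanced by (simp add: L_def)
    moreover have "(\<integral>\<zeta>. E \<zeta> * (sec_diff u ^^ k) (gauss s) (Z \<zeta>) \<partial>?MM) = B s"
      unfolding B_def by (rule fub[OF i2])
    ultimately show ?thesis unfolding F_eq using i1 i2 s by simp
  next
    case False
    then show ?thesis by (simp add: F_def H_def subord_def)
  qed
  \<comment> \<open>Removing the sign \<open>(-1) ^ Suc k\<close> leaves a nonnegative function with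
    integral 0.\<close>
  define D where "D s = indicator {0<..} s * s powr (- 1 - q) * B s" for s
  have D_eq: "D s = (-1) ^ Suc k * (\<integral>\<zeta>. F \<zeta> s \<partial>?MM)" for s
    unfolding FB D_def mult.assoc[symmetric] by (simp add: power_add[symmetric] mult_2[symmetric])
  have "integrable lborel D" "(\<integral>s. D s \<partial>lborel) = 0"
    unfolding D_eq[abs_def] using F_int F_zero by simp_all
  moreover have "D s \<ge> 0" for s using B_nonneg by (auto simp: D_def indicator_def)
  ultimately have "AE s in lborel. D s = 0"
    using integral_nonneg_eq_0_iff_AE[of lborel D] by auto
  then show ?thesis by (auto simp: D_def B_def elim!: eventually_mono)
qed

lemma L_gauss_zero:
  fixes p q :: real and u :: 'a
  assumes q: "real k < q" "q < real k + 1" and p: "p = 2 * q" and u: "u \<noteq> 0"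
    and int: "integrable M (\<lambda>\<omega>. norm (X \<omega>) powr p)"
    and pot: "\<And>x. L (\<lambda>y. norm (y - x) powr p) = 0" and s: "s > 0"
  shows "L (\<lambda>y. gauss s (x - y)) = 0"
proof (rule L_gauss_zero_if_AE[OF _ s])
  show "AE s in lborel. s > 0 \<longrightarrow> L (\<lambda>y. gauss s (x - y)) = 0"
    using energy_AE_zero[OF q p int pot, of u] L_gauss_zero_if_energy_zero[OF _ u]
    by (auto elim!: eventually_mono)
qed

end

section \<open>Measures annihilating Gaussians\<close>

text \<open>Balls alone are not closed under intersection. The inductive form allows the balls to be
  imposed one at a time.\<close>

inductive_set ball_inters :: "'a::metric_space set set" where
  UNIV: "UNIV \<in> ball_inters"
| Int_ball: "S \<in> ball_inters \<Longrightarrow> S \<inter> ball x r \<in> ball_inters"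

lemma ball_inters_borel: "S \<in> ball_inters \<Longrightarrow> S \<in> sets borel"
  by (induction rule: ball_inters.induct) auto

lemma Int_stable_ball_inters: "Int_stable ball_inters"
proof (rule Int_stableI)
  fix S T :: "'a set" assume "S \<in> ball_inters" "T \<in> ball_inters"
  show "S \<inter> T \<in> ball_inters"
    using \<open>T \<in> ball_inters\<close>
  proof induction
    case (Int_ball T x r)
    then show ?case using ball_inters.Int_ball[of "S \<inter> T" x r] by (simp add: Int_assoc)
  qed (simp add: \<open>S \<in> ball_inters\<close>)
qed

text \<open>By the Lindelof property every open set is a countable union of balls.\<close>

lemma sets_borel_eq_ball_inters:
  "sets (borel :: 'a::{metric_space, second_countable_topology} measure) = sigma_sets UNIV ball_inters"
proof
  show "sigma_sets UNIV ball_inters \<subseteq> sets (borel :: 'a measure)"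
    using ball_inters_borel sets.sigma_sets_subset[of ball_inters "borel :: 'a measure"] by auto
  interpret sigma_algebra UNIV "sigma_sets UNIV (ball_inters :: 'a set set)"
    by (rule sigma_algebra_sigma_sets) simp
  have ball: "ball x r \<in> sigma_sets UNIV ball_inters" for x :: 'a and r
    using ball_inters.Int_ball[OF ball_inters.UNIV, of x r] by auto
  have "U \<in> sigma_sets UNIV ball_inters" if "open U" for U :: "'a set"
  proof -
    define \<F> where "\<F> = {ball x r | x r. ball x r \<subseteq> U}"
    have "\<Union>\<F> = U"
    proof
      show "U \<subseteq> \<Union>\<F>"
      proof
        fix x assume "x \<in> U"
        with that obtain r where "r > 0" "ball x r \<subseteq> U" unfolding open_contains_ball by blast
        then have "x \<in> ball x r" "ball x r \<in> \<F>" by (auto simp: \<F>_def)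
        then show "x \<in> \<Union>\<F>" by blast
      qed
    qed (auto simp: \<F>_def)
    moreover obtain \<F>' where "\<F>' \<subseteq> \<F>" "countable \<F>'" "\<Union>\<F>' = \<Union>\<F>"
      by (rule Lindelof[of \<F>]) (auto simp: \<F>_def)
    moreover have "\<Union>\<F>' \<in> sigma_sets UNIV ball_inters"
      using \<open>\<F>' \<subseteq> \<F>\<close> \<open>countable \<F>'\<close> ball by (intro countable_Union) (auto simp: \<F>_def)
    ultimately show ?thesis by simp
  qed
  moreover have "sets (borel :: 'a measure) = sigma_sets UNIV {S. open S}" by (simp add: borel_def)
  ultimately show "sets (borel :: 'a measure) \<subseteq> sigma_sets UNIV ball_inters"
    using sigma_sets_mono[of "{S::'a set. open S}" UNIV ball_inters] by blast
qed

text \<open>The linear term makes the family stable, up to constants, under multiplication by powers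
  of \<open>gauss 1 (x - y)\<close>. For \<open>s > 0\<close> a member is a multiple of a translated
  Gaussian, by completing the square; \<open>a = 0\<close> and \<open>s = 0\<close> give the
  constant 1.\<close>

definition egauss :: "'a::real_inner \<Rightarrow> real \<Rightarrow> 'a \<Rightarrow> real" where
  "egauss a s y = exp (a \<bullet> y - s * (norm y)\<^sup>2)"

lemma egauss_eq_gauss:
  assumes "s > 0"
  shows "egauss a s y = exp ((norm a)\<^sup>2 / (4 * s)) * gauss s ((1 / (2 * s)) *\<^sub>R a - y)"
proof -
  have sq: "(norm (c *\<^sub>R a - y))\<^sup>2 = c\<^sup>2 * (norm a)\<^sup>2 - 2 * c * (a \<bullet> y) + (norm y)\<^sup>2" for c
    unfolding power2_norm_eq_inner power2_eq_square[of c]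
    by (simp add: inner_diff_left inner_diff_right inner_commute algebra_simps)
  have "a \<bullet> y - s * (norm y)\<^sup>2 = (norm a)\<^sup>2 / (4 * s) + - (s * (norm ((1 / (2 * s)) *\<^sub>R a - y))\<^sup>2)"
    unfolding sq using assms by (simp add: field_simps power2_eq_square)
  then show ?thesis unfolding egauss_def by (simp only: exp_add)
qed

lemma egauss_bounded:
  assumes "s > 0 \<or> s = 0 \<and> a = 0"
  obtains K where "K \<ge> 0" "\<And>y. \<bar>egauss a s y\<bar> \<le> K"
proof (cases "s > 0")
  case True
  show thesis
    by (rule that[of "exp ((norm a)\<^sup>2 / (4 * s))"])
      (use True in \<open>auto simp: egauss_eq_gauss abs_mult\<close>)
next
  case False
  then show thesis using assms by (intro that[of 1]) (auto simp: egauss_def)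
qed

lemma egauss_measurable [measurable]: "egauss a s \<in> borel_measurable borel"
  unfolding egauss_def by (intro borel_measurable_continuous_onI continuous_intros)

lemma egauss_mult_gauss_power:
  "egauss a s y * gauss 1 (x - y) ^ n =
     exp (- (real n * (norm x)\<^sup>2)) * egauss (a + (2 * real n) *\<^sub>R x) (s + real n) y"
  unfolding egauss_def exp_of_nat_mult[symmetric] exp_add[symmetric]
  by (simp add: power2_norm_eq_inner inner_add_left inner_diff_left inner_diff_right inner_commute algebra_simps)

context signed_functional
begin

lemma L_cmult: "L (\<lambda>y. c * f y) = c * L f"
proof -
  have "(\<lambda>\<omega>. \<epsilon> \<omega> * (c * f (X \<omega>))) = (\<lambda>\<omega>. c * (\<epsilon> \<omega> * f (X \<omega>)))" by (simp add: fun_eq_iff)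
  then show ?thesis unfolding L_def by (simp only: integral_mult_right_zero)
qed

text \<open>Powers of a Gaussian multiply any \<open>egauss\<close> into another one, so vanishing of \<open>L\<close> passes to
  polynomials and then, by Weierstrass, to continuous functions of \<open>gauss 1 (x - y)\<close>; the
  superlevel sets of the latter are balls.\<close>

lemma L_egauss_indicator_Int_ball:
  assumes S [measurable]: "S \<in> sets borel"
    and zero: "\<And>a s. s > 0 \<or> s = 0 \<and> a = 0 \<Longrightarrow> L (\<lambda>y. egauss a s y * indicator S y) = 0"
    and as: "s > 0 \<or> s = 0 \<and> a = 0"
  shows "L (\<lambda>y. egauss a s y * indicator (S \<inter> ball x r) y) = 0"
proof (cases "r > 0")
  case r: True
  define w where "w y = egauss a s y * indicator S y" for y
  define t where "t y = gauss 1 (x - y)" for y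
  have [measurable]: "w \<in> borel_measurable borel" "t \<in> borel_measurable borel"
    unfolding w_def t_def by measurable
  have t01: "0 \<le> t y" "t y \<le> 1" for y by (auto simp: t_def)
  obtain K where K: "K \<ge> 0" "\<And>y. \<bar>w y\<bar> \<le> K"
  proof -
    obtain K where "K \<ge> 0" "\<And>y. \<bar>egauss a s y\<bar> \<le> K" using egauss_bounded[OF as] by blast
    then show thesis by (intro that[of K]) (auto simp: w_def abs_mult split: split_indicator)
  qed
  have wb: "\<bar>w y * b\<bar> \<le> K * c" if "\<bar>b\<bar> \<le> c" for y b c
    unfolding abs_mult using that K by (intro mult_mono) auto
  have pow: "L (\<lambda>y. w y * t y ^ n) = 0" for n
  proof -
    have "w y * t y ^ n = exp (- (real n * (norm x)\<^sup>2)) *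
        (egauss (a + (2 * real n) *\<^sub>R x) (s + real n) y * indicator S y)" for y
      using egauss_mult_gauss_power[of a s y x n] by (simp add: w_def t_def mult_ac)
    then have "L (\<lambda>y. w y * t y ^ n) = exp (- (real n * (norm x)\<^sup>2)) *
        L (\<lambda>y. egauss (a + (2 * real n) *\<^sub>R x) (s + real n) y * indicator S y)"
      by (simp only: L_cmult)
    moreover have "s + real n > 0 \<or> s + real n = 0 \<and> a + (2 * real n) *\<^sub>R x = 0"
      using as by (cases n) auto
    ultimately show ?thesis using zero by simp
  qed
  have cont: "L (\<lambda>y. w y * h (t y)) = 0"
    if h: "continuous_on UNIV h" for h :: "real \<Rightarrow> real"
  proof -
    have [measurable]: "h \<in> borel_measurable borel" using h by (rule borel_measurable_continuous_onI)
    have "bounded (h ` {0..1})"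
      using h by (intro compact_imp_bounded compact_continuous_image continuous_on_subset[OF h]) auto
    then obtain b where b: "\<And>z. z \<in> {0..1} \<Longrightarrow> \<bar>h z\<bar> \<le> b" 
      unfolding bounded_iff real_norm_def by blast
    have "\<bar>L (\<lambda>y. w y * h (t y))\<bar> \<le> e" if "e > 0" for e
    proof -
      \<comment> \<open>\<open>K * measure M (space M)\<close> may be 0, hence the 1 in the
        denominator.\<close>
      define d where "d = e / (K * measure M (space M) + 1)"
      have "K * measure M (space M) \<ge> 0" using K by auto
      then have "d > 0" and d: "K * d * measure M (space M) \<le> e"
        using \<open>e > 0\<close> by (auto simp: d_def field_simps)
      obtain g where "real_polynomial_function g" and g: "\<And>z. z \<in> {0..1} \<Longrightarrow> \<bar>h z - g z\<bar> < d"
        using Stone_Weierstrass_real_polynomial_function[of "{0..1}" h d] \<open>d > 0\<close>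
          continuous_on_subset[OF h] by auto
      then obtain \<alpha> n where ga: "g = (\<lambda>z. \<Sum>i\<le>n. \<alpha> i * z ^ i)"
        unfolding real_polynomial_function_iff_sum by blast
      have ipow: "integrable M (\<lambda>\<omega>. \<epsilon> \<omega> * (w (X \<omega>) * t (X \<omega>) ^ i))" for i
        using t01 by (intro integrable_L[of "\<lambda>y. w y * t y ^ i" "K * 1"] wb) (auto simp: power_le_one)
      have eq: "\<epsilon> \<omega> * (w (X \<omega>) * g (t (X \<omega>))) = (\<Sum>i\<le>n. \<alpha> i * (\<epsilon> \<omega> * (w (X \<omega>) * t (X \<omega>) ^ i)))" for \<omega>
        unfolding ga sum_distrib_left by (intro sum.cong refl) simp
      have ig: "integrable M (\<lambda>\<omega>. \<epsilon> \<omega> * (w (X \<omega>) * g (t (X \<omega>))))"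
        unfolding eq using ipow by auto
      have Lg: "L (\<lambda>y. w y * g (t y)) = 0"
        unfolding L_def eq using ipow pow by (subst Bochner_Integration.integral_sum) (auto simp: L_def)
      have [measurable]: "g \<in> borel_measurable borel" unfolding ga by measurable
      have ih: "integrable M (\<lambda>\<omega>. \<epsilon> \<omega> * (w (X \<omega>) * h (t (X \<omega>))))"
        using t01 b by (intro integrable_L[of "\<lambda>y. w y * h (t y)" "K * b"] wb) auto
      have "L (\<lambda>y. w y * h (t y)) = (\<integral>\<omega>. \<epsilon> \<omega> * (w (X \<omega>) * (h (t (X \<omega>)) - g (t (X \<omega>)))) \<partial>M)"
        using Lg ih ig by (simp add: L_def right_diff_distrib)
      also have "\<bar>\<dots>\<bar> \<le> K * d * measure M (space M)"
        using t01 g by (intro abs_integral_eps_le wb less_imp_le) auto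
      finally show ?thesis using d by simp
    qed
    then have "\<bar>L (\<lambda>y. w y * h (t y))\<bar> \<le> 0" by (rule field_le_epsilon) simp
    then show ?thesis by simp
  qed
  \<comment> \<open>The value of \<open>t\<close> on the sphere of radius \<open>r\<close> about
    \<open>x\<close>.\<close>
  define \<tau> where "\<tau> = exp (- r\<^sup>2)"
  have ball: "y \<in> ball x r \<longleftrightarrow> t y > \<tau>" for y
  proof -
    have "norm (x - y) < r \<longleftrightarrow> (norm (x - y))\<^sup>2 < r\<^sup>2"
      using r power_strict_mono[of "norm (x - y)" r 2] power_less_imp_less_base[of "norm (x - y)" 2 r] by auto
    then show ?thesis by (simp add: \<tau>_def t_def dist_norm)
  qed
  \<comment> \<open>Continuous ramps that converge pointwise to the indicator of the values above
    \<open>\<tau>\<close>.\<close>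
  define h where "h n z = min 1 (real n * max 0 (z - \<tau>))" for n z
  have hlim: "(\<lambda>n. h n (t y)) \<longlonglongrightarrow> indicator (ball x r) y" for y
  proof (cases "t y > \<tau>")
    case True
    obtain N :: nat where N: "1 / (t y - \<tau>) < real N" using reals_Archimedean2 by blast
    have "h n (t y) = 1" if "n \<ge> N" for n
    proof -
      have "1 < real N * (t y - \<tau>)" using N True by (simp add: field_simps)
      also have "\<dots> \<le> real n * (t y - \<tau>)" using that True by (intro mult_right_mono) auto
      finally show ?thesis using True by (simp add: h_def)
    qed
    then have "(\<lambda>n. h n (t y)) \<longlonglongrightarrow> 1" by (intro tendsto_eventually eventually_sequentiallyI[of N])
    then show ?thesis using ball True by simp
  next
    case False
    then have "h n (t y) = 0" for n by (simp add: h_def)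
    then show ?thesis using ball False by simp
  qed
  have "(\<lambda>n. L (\<lambda>y. w y * h n (t y))) \<longlonglongrightarrow> L (\<lambda>y. w y * indicator (ball x r) y)"
    unfolding L_def
  proof (rule integral_dominated_convergence[where w="\<lambda>_. K * 1"])
    show "(\<lambda>\<omega>. \<epsilon> \<omega> * (w (X \<omega>) * h n (t (X \<omega>)))) \<in> borel_measurable M" for n
      unfolding h_def by measurable
    have [measurable]: "indicator (ball x r) \<in> borel_measurable borel"
      by (intro borel_measurable_indicator) simp
    show "(\<lambda>\<omega>. \<epsilon> \<omega> * (w (X \<omega>) * indicator (ball x r) (X \<omega>))) \<in> borel_measurable M"
      by measurable
    show "AE \<omega> in M. norm (\<epsilon> \<omega> * (w (X \<omega>) * h n (t (X \<omega>)))) \<le> K * 1" for n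
      unfolding real_norm_def by (intro AE_I2 abs_eps_mult_le wb) (auto simp: h_def)
  qed (auto intro!: tendsto_intros hlim)
  moreover have "L (\<lambda>y. w y * h n (t y)) = 0" for n
    unfolding h_def by (intro cont continuous_intros)
  ultimately have "L (\<lambda>y. w y * indicator (ball x r) y) = 0"
    by (simp add: LIMSEQ_const_iff)
  then show ?thesis by (simp add: w_def indicator_inter_arith mult.assoc)
qed (simp add: L_def ball_empty)

text \<open>The induction has to carry all admissible \<open>egauss\<close>, because adding a ball
  uses the vanishing for other parameters. The parameters 0 and 0 then give the bare
  indicator.\<close>

lemma L_indicator_ball_inters:
  assumes gauss: "\<And>s x. s > 0 \<Longrightarrow> L (\<lambda>y. gauss s (x - y)) = 0" and S: "S \<in> ball_inters"
  shows "L (indicator S) = 0"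
proof -
  have "L (\<lambda>y. egauss a s y * indicator S y) = 0" if "s > 0 \<or> s = 0 \<and> a = 0" for a s
    using S that
  proof (induction arbitrary: a s)
    case UNIV
    show ?case
    proof (cases "s > 0")
      case True
      have "L (\<lambda>y. egauss a s y * indicator UNIV y) =
          exp ((norm a)\<^sup>2 / (4 * s)) * L (\<lambda>y. gauss s ((1 / (2 * s)) *\<^sub>R a - y))"
        unfolding egauss_eq_gauss[OF True] by (simp add: L_cmult)
      then show ?thesis using gauss[OF True] by simp
    next
      case False
      then show ?thesis using UNIV eps_balanced by (simp add: L_def egauss_def)
    qed
  next
    case (Int_ball S x r)
    then show ?case by (intro L_egauss_indicator_Int_ball ball_inters_borel) auto
  qed
  from this[of 0 0] show ?thesis by (simp add: egauss_def)
qed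

end

section \<open>Potentials determine measures\<close>

text \<open>For even \<open>p\<close> the potential would be a polynomial in \<open>x\<close> that
  sees only moments of order at most \<open>p\<close>; this is why even \<open>p\<close> is
  excluded.\<close>

theorem potential_determines_measure:
  fixes \<mu> \<nu> :: "'a::{real_inner, polish_space} measure" and p :: real
  assumes "prob_space \<mu>" "prob_space \<nu>" and sets: "sets \<mu> = sets borel" "sets \<nu> = sets borel"
    and p: "p > 0" "\<not> (\<exists>k::nat. p = 2 * real k)"
    and int: "integrable \<mu> (\<lambda>x. norm x powr p)" "integrable \<nu> (\<lambda>x. norm x powr p)"
    and pot: "\<And>x. (\<integral>y. norm (y - x) powr p \<partial>\<mu>) = (\<integral>y. norm (y - x) powr p \<partial>\<nu>)"
  shows "\<mu> = \<nu>"
proof (cases "\<exists>u::'a. u \<noteq> 0")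
  case True
  \<comment> \<open>Differencing and decay at infinity require a nonzero direction, so the zero
    space is a separate case.\<close>
  then obtain u :: 'a where u: "u \<noteq> 0" by blast
  interpret m: prob_space \<mu> by fact
  interpret n: prob_space \<nu> by fact
  have [measurable_cong]: "sets \<mu> = sets borel" "sets \<nu> = sets borel" by (rule sets)+
  \<comment> \<open>\<open>\<mu> - \<nu>\<close> is realised on \<open>\<mu> \<Otimes>\<^sub>M \<nu> \<Otimes>\<^sub>M {True, False}\<close>, where the Boolean selects the coordinate and the sign.\<close>
  let ?P = "\<mu> \<Otimes>\<^sub>M \<nu>" and ?B = "count_space (UNIV :: bool set)"
  interpret P: pair_prob_space \<mu> \<nu> ..
  interpret B: finite_measure ?B by (rule finite_measure_count_space) simp
  interpret Q: pair_sigma_finite ?P ?B ..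
  define \<epsilon> :: "('a \<times> 'a) \<times> bool \<Rightarrow> real" where "\<epsilon> \<omega> = (if snd \<omega> then 1 else - 1)" for \<omega>
  define X :: "('a \<times> 'a) \<times> bool \<Rightarrow> 'a" where "X \<omega> = (if snd \<omega> then fst (fst \<omega>) else snd (fst \<omega>))" for \<omega>
  have [measurable]: "\<epsilon> \<in> borel_measurable (?P \<Otimes>\<^sub>M ?B)" "X \<in> borel_measurable (?P \<Otimes>\<^sub>M ?B)"
    unfolding \<epsilon>_def X_def by measurable
  have int_B: "(\<integral>b. f b \<partial>?B) = f True + f False" for f :: "bool \<Rightarrow> real"
    by (simp add: lebesgue_integral_count_space_finite UNIV_bool)
  have fst_snd: "integrable ?P (\<lambda>\<zeta>. h (fst \<zeta>))" "(\<integral>\<zeta>. h (fst \<zeta>) \<partial>?P) = (\<integral>y. h y \<partial>\<mu>)"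
    "integrable ?P (\<lambda>\<zeta>. h (snd \<zeta>))" "(\<integral>\<zeta>. h (snd \<zeta>) \<partial>?P) = (\<integral>y. h y \<partial>\<nu>)"
    if h: "integrable \<mu> h" "integrable \<nu> h" for h :: "'a \<Rightarrow> real"
  proof -
    show 1: "integrable ?P (\<lambda>\<zeta>. h (fst \<zeta>))"
      using h by (intro P.Fubini_integrable) auto
    show 2: "integrable ?P (\<lambda>\<zeta>. h (snd \<zeta>))"
      using h by (intro P.Fubini_integrable) auto
    show "(\<integral>\<zeta>. h (fst \<zeta>) \<partial>?P) = (\<integral>y. h y \<partial>\<mu>)"
      using P.integral_fst'[OF 1] by (simp add: n.prob_space)
    show "(\<integral>\<zeta>. h (snd \<zeta>) \<partial>?P) = (\<integral>y. h y \<partial>\<nu>)"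
      using P.integral_fst'[OF 2] by (simp add: m.prob_space)
  qed
  have int_X: "integrable (?P \<Otimes>\<^sub>M ?B) (\<lambda>\<omega>. h (X \<omega>))"
    if h: "integrable \<mu> h" "integrable \<nu> h" for h :: "'a \<Rightarrow> real"
  proof (rule Q.Fubini_integrable)
    have [measurable]: "h \<in> borel_measurable borel"
      using borel_measurable_integrable[OF h(1)] by simp
    show "(\<lambda>\<omega>. h (X \<omega>)) \<in> borel_measurable (?P \<Otimes>\<^sub>M ?B)" by measurable
    show "integrable ?P (\<lambda>\<zeta>. \<integral>b. norm (h (X (\<zeta>, b))) \<partial>?B)"
      using fst_snd[of "\<lambda>x. \<bar>h x\<bar>"] h by (simp add: int_B X_def)
  qed (simp add: integrable_count_space)
  have int_eX: "integrable (?P \<Otimes>\<^sub>M ?B) (\<lambda>\<omega>. \<epsilon> \<omega> * h (X \<omega>))"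
    if "integrable \<mu> h" "integrable \<nu> h" for h :: "'a \<Rightarrow> real"
  proof (rule Bochner_Integration.integrable_bound[OF int_X[OF that]])
    have [measurable]: "h \<in> borel_measurable borel"
      using borel_measurable_integrable[OF that(1)] by simp
    show "(\<lambda>\<omega>. \<epsilon> \<omega> * h (X \<omega>)) \<in> borel_measurable (?P \<Otimes>\<^sub>M ?B)" by measurable
  qed (simp add: \<epsilon>_def)
  have val: "(\<integral>\<omega>. \<epsilon> \<omega> * h (X \<omega>) \<partial>(?P \<Otimes>\<^sub>M ?B)) = (\<integral>y. h y \<partial>\<mu>) - (\<integral>y. h y \<partial>\<nu>)"
    if "integrable \<mu> h" "integrable \<nu> h" for h :: "'a \<Rightarrow> real"
    using Q.integral_fst'[OF int_eX[OF that]] fst_snd[OF that]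
    by (simp add: int_B \<epsilon>_def X_def)
  interpret signed_functional "?P \<Otimes>\<^sub>M ?B" \<epsilon> X
  proof -
    have 1: "finite_measure (?P \<Otimes>\<^sub>M ?B)"
      by (rule finite_measure_pair_measure) unfold_locales
    have 2: "(\<integral>\<omega>. \<epsilon> \<omega> \<partial>(?P \<Otimes>\<^sub>M ?B)) = 0"
      using val[of "\<lambda>_. 1"] by (simp add: m.prob_space n.prob_space)
    show "signed_functional (?P \<Otimes>\<^sub>M ?B) \<epsilon> X"
      using 1 2 by (intro signed_functional.intro signed_functional_axioms.intro) (auto simp: \<epsilon>_def)
  qed
  have L_eq: "L h = (\<integral>y. h y \<partial>\<mu>) - (\<integral>y. h y \<partial>\<nu>)" if "integrable \<mu> h" "integrable \<nu> h" for h
    unfolding L_def by (rule val[OF that])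
  have L_pot: "L (\<lambda>y. norm (y - x) powr p) = 0" for x
    using pot[of x] p(1)
    by (subst L_eq) (auto intro!: integrable_norm_diff_powr int sets assms(1,2))
  \<comment> \<open>As \<open>p\<close> is not an even integer, \<open>p / 2\<close> lies strictly
    between \<open>k\<close> and \<open>k + 1\<close>.\<close>
  define k where "k = nat \<lfloor>p / 2\<rfloor>"
  have "real k = real_of_int \<lfloor>p / 2\<rfloor>" using p(1) by (simp add: k_def)
  then have k: "real k \<le> p / 2" "p / 2 < real k + 1" by linarith+
  moreover have "real k \<noteq> p / 2" using p(2) by (metis mult.commute nonzero_divide_eq_eq zero_neq_numeral)
  ultimately have k': "real k < p / 2" by simp
  have "L (\<lambda>y. gauss s (x - y)) = 0" if "s > 0" for s x
    using L_gauss_zero[OF k' k(2) _ u int_X[OF int] L_pot that] by simp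
  then have balls: "L (indicator S) = 0" if "S \<in> ball_inters" for S
    using that by (rule L_indicator_ball_inters)
  show "\<mu> = \<nu>"
  proof (rule measure_eqI_generator_eq[where \<Omega>=UNIV and E=ball_inters and A="\<lambda>_. UNIV"])
    fix S :: "'a set" assume S: "S \<in> ball_inters"
    then have [measurable]: "S \<in> sets borel" by (rule ball_inters_borel)
    have "integrable \<mu> (indicator S :: 'a \<Rightarrow> real)" "integrable \<nu> (indicator S :: 'a \<Rightarrow> real)"
      by (auto simp: sets less_top[symmetric])
    then have "measure \<mu> S = measure \<nu> S"
      using balls[OF S] by (simp add: L_eq sets)
    then show "emeasure \<mu> S = emeasure \<nu> S" by (simp add: m.emeasure_eq_measure n.emeasure_eq_measure)
  qed (auto simp: Int_stable_ball_inters sets sets_borel_eq_ball_inters ball_inters.UNIV)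
next
  case False
  then have "A = {} \<or> A = UNIV" for A :: "'a set" by (metis (full_types) UNIV_eq_I all_not_in_conv)
  moreover have "emeasure \<mu> UNIV = emeasure \<nu> UNIV"
    using prob_space.emeasure_space_1[OF assms(1)] prob_space.emeasure_space_1[OF assms(2)]
      sets_eq_imp_space_eq[OF sets(1)] sets_eq_imp_space_eq[OF sets(2)] by simp
  ultimately show ?thesis using sets by (intro measure_eqI) (auto, metis emeasure_empty)
qed

section \<open>Metric characterisation of Dirac measures\<close>

text \<open>Convexity at the midpoint. The constant is attained for \<open>a = b\<close>, and the
  characterisation of Dirac measures depends on this sharpness.\<close>

lemma powr_add_le_powr:
  fixes a b p :: real
  assumes "p \<ge> 1" "a \<ge> 0" "b \<ge> 0"
  shows "(a + b) powr p \<le> 2 powr (p - 1) * (a powr p + b powr p)"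
proof (cases "a = 0 \<or> b = 0")
  case True
  have "(2::real) powr 0 \<le> 2 powr (p - 1)" using assms by (intro powr_mono) auto
  then have "1 \<le> (2::real) powr (p - 1)" by simp
  then have "c powr p \<le> 2 powr (p - 1) * c powr p" for c :: real
    by (simp add: mult_le_cancel_right1)
  with True show ?thesis by auto
next
  case False
  then have ab: "a > 0" "b > 0" using assms by auto
  have conv: "((1/2) * a + (1/2) * b) powr p \<le> (1/2) * a powr p + (1/2) * b powr p"
    using convex_onD[OF powr_convex[OF assms(1)], of "1/2" a b] ab by simp
  have "(a + b) powr p = 2 powr p * ((1/2) * a + (1/2) * b) powr p"
    using ab by (simp add: powr_mult[symmetric])
  also have "\<dots> \<le> 2 powr p * ((1/2) * a powr p + (1/2) * b powr p)"
    using conv by (rule mult_left_mono) simp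
  also have "\<dots> = 2 powr (p - 1) * (a powr p + b powr p)"
    by (simp add: powr_diff field_simps)
  finally show ?thesis .
qed

lemma norm_diff_powr_le:
  fixes a b y :: "'a::real_normed_vector"
  assumes "p \<ge> 1"
  shows "norm (a - b) powr p \<le> 2 powr (p - 1) * (norm (a - y) powr p + norm (b - y) powr p)"
proof -
  have "norm (a - b) powr p \<le> (norm (a - y) + norm (b - y)) powr p"
    using assms norm_triangle_ineq4[of "a - y" "b - y"] by (intro powr_mono2) auto
  also have "\<dots> \<le> 2 powr (p - 1) * (norm (a - y) powr p + norm (b - y) powr p)"
    using assms by (intro powr_add_le_powr) auto
  finally show ?thesis .
qed

text \<open>A strict triangle inequality stays strict under the increasing power, so the argument
  also covers \<open>p = 1\<close>, where the power is not strictly convex.\<close>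

lemma norm_diff_powr_eqD:
  fixes a b y :: "'a::real_normed_vector"
  assumes p: "p \<ge> 1"
    and eq: "norm (a - b) powr p = 2 powr (p - 1) * (norm (a - y) powr p + norm (b - y) powr p)"
  shows "norm (a - b) = norm (a - y) + norm (b - y)"
proof (rule ccontr)
  assume "norm (a - b) \<noteq> norm (a - y) + norm (b - y)"
  then have "norm (a - b) < norm (a - y) + norm (b - y)"
    using norm_triangle_ineq4[of "a - y" "b - y"] by simp
  then have "norm (a - b) powr p < (norm (a - y) + norm (b - y)) powr p"
    using p by (intro powr_less_mono2) auto
  also have "\<dots> \<le> 2 powr (p - 1) * (norm (a - y) powr p + norm (b - y) powr p)"
    using p by (intro powr_add_le_powr) auto
  finally show False using eq by simp
qed

lemma AE_eq_imp_return:
  fixes \<mu> :: "'a::t1_space measure"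
  assumes "prob_space \<mu>" and sets: "sets \<mu> = sets borel" and ae: "AE y in \<mu>. y = x"
  shows "\<mu> = return borel x"
proof (rule measure_eqI)
  interpret prob_space \<mu> by fact
  fix A assume A: "A \<in> sets \<mu>"
  show "emeasure \<mu> A = emeasure (return borel x) A"
  proof (cases "x \<in> A")
    case True
    with ae have "AE y in \<mu>. y \<in> A" by (auto elim!: eventually_mono)
    then show ?thesis using True A sets by (simp add: emeasure_eq_1_AE)
  next
    case False
    with ae have "AE y in \<mu>. y \<notin> A" by (auto elim!: eventually_mono)
    then have "emeasure \<mu> A = 0" using A AE_iff_null_sets[OF A] by auto
    then show ?thesis using False A sets by simp
  qed
qed (simp add: sets)

text \<open>By the Lindelof property the union of all open null sets is null. Its complement, the
  support, carries the full mass and cannot be a single point.\<close>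

lemma not_return_imp_two_support_points:
  fixes \<mu> :: "'a::{t1_space, second_countable_topology} measure"
  assumes "prob_space \<mu>" and sets: "sets \<mu> = sets borel" and nd: "\<And>x. \<mu> \<noteq> return borel x"
  obtains a b where "a \<noteq> b" "\<And>C. closed C \<Longrightarrow> AE y in \<mu>. y \<in> C \<Longrightarrow> a \<in> C \<and> b \<in> C"
proof -
  interpret prob_space \<mu> by fact
  define \<F> where "\<F> = {U. open U \<and> U \<in> null_sets \<mu>}"
  obtain \<F>' where \<F>': "\<F>' \<subseteq> \<F>" "countable \<F>'" "\<Union>\<F>' = \<Union>\<F>"
    by (rule Lindelof[of \<F>]) (auto simp: \<F>_def)
  have "(\<Union>U\<in>\<F>'. U) \<in> null_sets \<mu>"
    using \<F>' by (intro null_sets_UN') (auto simp: \<F>_def)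
  then have null: "\<Union>\<F> \<in> null_sets \<mu>" using \<F>'(3) by simp
  then have ae: "AE y in \<mu>. y \<notin> \<Union>\<F>" by (rule AE_not_in)
  have "\<exists>a. a \<notin> \<Union>\<F>"
  proof (rule ccontr)
    assume "\<nexists>a. a \<notin> \<Union>\<F>"
    then have all: "a \<in> \<Union>\<F>" for a by blast
    have "AE y in \<mu>. False" using ae by (rule eventually_mono) (erule notE, rule all)
    then show False by simp
  qed
  then obtain a where a: "a \<notin> \<Union>\<F>" by blast
  have "\<exists>b. b \<noteq> a \<and> b \<notin> \<Union>\<F>"
  proof (rule ccontr)
    assume "\<nexists>b. b \<noteq> a \<and> b \<notin> \<Union>\<F>"
    then have all: "y = a" if "y \<notin> \<Union>\<F>" for y using that by blast
    have "AE y in \<mu>. y = a" using ae by (rule eventually_mono) (rule all)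
    then have "\<mu> = return borel a" by (rule AE_eq_imp_return[OF assms(1) sets])
    with nd[of a] show False by contradiction
  qed
  then obtain b where b: "b \<noteq> a" "b \<notin> \<Union>\<F>" by blast
  have supp: "c \<in> C" if "closed C" "AE y in \<mu>. y \<in> C" "c \<notin> \<Union>\<F>" for C c
  proof (rule ccontr)
    assume "c \<notin> C"
    have "- C \<in> sets \<mu>" using that(1) by (simp add: sets)
    moreover have "AE y in \<mu>. y \<notin> - C" using that(2) by simp
    ultimately have "- C \<in> null_sets \<mu>" by (simp only: AE_iff_null_sets)
    then have "- C \<in> \<F>" using that(1) by (simp add: \<F>_def open_Compl)
    moreover have "c \<in> - C" using \<open>c \<notin> C\<close> by simp
    ultimately have "c \<in> \<Union>\<F>" by (rule UnionI)
    with that(3) show False by contradiction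
  qed
  show thesis
  proof (rule that)
    show "a \<noteq> b" using b(1) by simp
    show "a \<in> C \<and> b \<in> C" if "closed C" "AE y in \<mu>. y \<in> C" for C
      using supp[OF that a] supp[OF that b(2)] by (rule conjI)
  qed
qed

definition pmoment :: "real \<Rightarrow> 'a::real_normed_vector measure \<Rightarrow> 'a \<Rightarrow> real" where
  "pmoment p \<mu> x = (\<integral>y. norm (y - x) powr p \<partial>\<mu>)"

definition cost :: "real \<Rightarrow> ('a::real_normed_vector \<times> 'a) measure \<Rightarrow> ennreal" where
  "cost p \<pi> = (\<integral>\<^sup>+ z. ennreal (norm (fst z - snd z) powr p) \<partial>\<pi>)"

text \<open>Every \<open>\<nu>\<close> is a metric midpoint of \<open>\<mu>\<close> and some \<open>\<eta>\<close>. This is a metric characterisation of the Dirac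
  measures.\<close>

definition dilatable :: "real \<Rightarrow> 'a::real_normed_vector measure \<Rightarrow> bool" where
  "dilatable p \<mu> \<longleftrightarrow> (\<forall>\<nu>\<in>Wasserstein_space p. \<exists>\<eta>\<in>Wasserstein_space p.
     wasserstein_dist p \<eta> \<mu> = 2 * wasserstein_dist p \<nu> \<mu> \<and>
     wasserstein_dist p \<nu> \<eta> = wasserstein_dist p \<nu> \<mu>)"

section \<open>Couplings, moments and distances to Dirac measures\<close>

lemma pmoment_nonneg: "pmoment p \<mu> x \<ge> 0"
  by (simp add: pmoment_def)

lemma wasserstein_dist_cost:
  "wasserstein_dist p \<mu> \<nu> = enn2real (INF \<pi>\<in>couplings \<mu> \<nu>. cost p \<pi>) powr (1 / p)"
  by (simp add: wasserstein_dist_def cost_def)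

lemma Wasserstein_spaceI:
  fixes \<mu> :: "'a::{real_normed_vector, second_countable_topology} measure"
  assumes "prob_space \<mu>" "sets \<mu> = sets borel" "integrable \<mu> (\<lambda>y. norm y powr p)"
  shows "\<mu> \<in> Wasserstein_space p"
  using assms nn_integral_eq_integral[OF assms(3)] by (simp add: Wasserstein_space_def)

lemma couplingsD:
  fixes \<mu> :: "'a::{real_normed_vector, second_countable_topology} measure"
  assumes "\<pi> \<in> couplings \<mu> \<nu>"
  shows "fst \<in> \<pi> \<rightarrow>\<^sub>M borel" "snd \<in> \<pi> \<rightarrow>\<^sub>M borel" "sets \<pi> = sets (borel \<Otimes>\<^sub>M borel)"
    "distr \<pi> borel fst = \<mu>" "distr \<pi> borel snd = \<nu>" "prob_space \<pi>"
proof -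
  show s: "sets \<pi> = sets (borel \<Otimes>\<^sub>M borel)" and "distr \<pi> borel fst = \<mu>" "distr \<pi> borel snd = \<nu>" "prob_space \<pi>"
    using assms by (auto simp: couplings_def)
  have [measurable_cong]: "sets \<pi> = sets (borel \<Otimes>\<^sub>M borel)" by fact
  show "fst \<in> \<pi> \<rightarrow>\<^sub>M borel" "snd \<in> \<pi> \<rightarrow>\<^sub>M borel" by measurable
qed

lemma coupling_nn_integral:
  fixes \<mu> :: "'a::{real_normed_vector, second_countable_topology} measure"
  assumes "\<pi> \<in> couplings \<mu> \<nu>" and "f \<in> borel_measurable borel"
  shows "(\<integral>\<^sup>+ z. f (fst z) \<partial>\<pi>) = (\<integral>\<^sup>+ y. f y \<partial>\<mu>)" "(\<integral>\<^sup>+ z. f (snd z) \<partial>\<pi>) = (\<integral>\<^sup>+ y. f y \<partial>\<nu>)"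
  using nn_integral_distr[OF couplingsD(1)[OF assms(1)], of f] nn_integral_distr[OF couplingsD(2)[OF assms(1)], of f]
    couplingsD(4,5)[OF assms(1)] assms(2) by auto

lemma map_coupling:
  fixes \<mu> :: "'a::{real_normed_vector, second_countable_topology} measure"
  assumes "prob_space \<mu>" and [measurable_cong]: "sets \<mu> = sets borel" and [measurable]: "f \<in> borel_measurable borel"
  shows "distr \<mu> (borel \<Otimes>\<^sub>M borel) (\<lambda>y. (y, f y)) \<in> couplings \<mu> (distr \<mu> borel f)"
    and "cost p (distr \<mu> (borel \<Otimes>\<^sub>M borel) (\<lambda>y. (y, f y))) = (\<integral>\<^sup>+ y. ennreal (norm (y - f y) powr p) \<partial>\<mu>)"
proof -
  interpret prob_space \<mu> by fact
  have m: "(\<lambda>y. (y, f y)) \<in> \<mu> \<rightarrow>\<^sub>M borel \<Otimes>\<^sub>M borel" by measurable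
  have "distr \<mu> borel (\<lambda>y. y) = \<mu>" using assms(2) by (intro distr_id2) simp
  then show "distr \<mu> (borel \<Otimes>\<^sub>M borel) (\<lambda>y. (y, f y)) \<in> couplings \<mu> (distr \<mu> borel f)"
    using m by (auto simp: couplings_def distr_distr comp_def intro!: prob_space_distr)
  show "cost p (distr \<mu> (borel \<Otimes>\<^sub>M borel) (\<lambda>y. (y, f y))) = (\<integral>\<^sup>+ y. ennreal (norm (y - f y) powr p) \<partial>\<mu>)"
    unfolding cost_def by (subst nn_integral_distr[OF m]) auto
qed

lemma wasserstein_dist_sym:
  fixes \<mu> \<nu> :: "'a::{real_normed_vector, second_countable_topology} measure"
  shows "wasserstein_dist p \<mu> \<nu> = wasserstein_dist p \<nu> \<mu>"
proof -
  have le: "(INF \<pi>\<in>couplings \<nu> \<mu>. cost p \<pi>) \<le> (INF \<pi>\<in>couplings \<mu> \<nu>. cost p \<pi>)" for \<mu> \<nu> :: "'a measure"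
  proof (rule INF_greatest)
    fix \<pi> assume \<pi>: "\<pi> \<in> couplings \<mu> \<nu>"
    have [measurable_cong]: "sets \<pi> = sets (borel \<Otimes>\<^sub>M borel)" by (rule couplingsD(3)[OF \<pi>])
    interpret prob_space \<pi> by (rule couplingsD(6)[OF \<pi>])
    define \<rho> where "\<rho> = distr \<pi> (borel \<Otimes>\<^sub>M borel) (\<lambda>z. (snd z, fst z))"
    have m: "(\<lambda>z. (snd z, fst z)) \<in> \<pi> \<rightarrow>\<^sub>M borel \<Otimes>\<^sub>M borel" by measurable
    have "\<rho> \<in> couplings \<nu> \<mu>"
      using m couplingsD(4,5)[OF \<pi>]
      by (auto simp: couplings_def \<rho>_def distr_distr comp_def intro!: prob_space_distr)
    moreover have "cost p \<rho> = cost p \<pi>"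
      unfolding cost_def \<rho>_def by (subst nn_integral_distr[OF m]) (auto simp: norm_minus_commute)
    ultimately show "(INF \<pi>\<in>couplings \<nu> \<mu>. cost p \<pi>) \<le> cost p \<pi>" by (metis INF_lower)
  qed
  show ?thesis unfolding wasserstein_dist_cost using antisym[OF le[of \<mu> \<nu>] le[of \<nu> \<mu>]] by simp
qed

lemma product_coupling:
  fixes \<mu> \<nu> :: "'a::{real_normed_vector, second_countable_topology} measure"
  assumes "prob_space \<mu>" "prob_space \<nu>" and sets: "sets \<mu> = sets borel" "sets \<nu> = sets borel"
  shows "\<mu> \<Otimes>\<^sub>M \<nu> \<in> couplings \<mu> \<nu>"
proof -
  interpret m: prob_space \<mu> by fact
  interpret n: prob_space \<nu> by fact
  interpret P: pair_prob_space \<mu> \<nu> ..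
  have [measurable_cong]: "sets \<mu> = sets borel" "sets \<nu> = sets borel" by (rule sets)+
  have sp: "space \<mu> = UNIV" "space \<nu> = UNIV"
    using sets_eq_imp_space_eq[OF sets(1)] sets_eq_imp_space_eq[OF sets(2)] by simp_all
  have "distr (\<mu> \<Otimes>\<^sub>M \<nu>) borel fst = \<mu>"
  proof (rule measure_eqI)
    fix A assume "A \<in> sets (distr (\<mu> \<Otimes>\<^sub>M \<nu>) borel fst)"
    then have A: "A \<in> sets borel" by simp
    have "fst -` A \<inter> space (\<mu> \<Otimes>\<^sub>M \<nu>) = A \<times> space \<nu>" by (auto simp: space_pair_measure sp)
    moreover have "emeasure (\<mu> \<Otimes>\<^sub>M \<nu>) (A \<times> space \<nu>) = emeasure \<mu> A * emeasure \<nu> (space \<nu>)"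
      using A sets(1) by (intro n.emeasure_pair_measure_Times) auto
    ultimately show "emeasure (distr (\<mu> \<Otimes>\<^sub>M \<nu>) borel fst) A = emeasure \<mu> A"
      using A by (simp add: emeasure_distr n.emeasure_space_1)
  qed (simp add: sets)
  moreover have "distr (\<mu> \<Otimes>\<^sub>M \<nu>) borel snd = \<nu>"
  proof (rule measure_eqI)
    fix A assume "A \<in> sets (distr (\<mu> \<Otimes>\<^sub>M \<nu>) borel snd)"
    then have A: "A \<in> sets borel" by simp
    have "snd -` A \<inter> space (\<mu> \<Otimes>\<^sub>M \<nu>) = space \<mu> \<times> A" by (auto simp: space_pair_measure sp)
    moreover have "emeasure (\<mu> \<Otimes>\<^sub>M \<nu>) (space \<mu> \<times> A) = emeasure \<mu> (space \<mu>) * emeasure \<nu> A"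
      using A sets(2) by (intro n.emeasure_pair_measure_Times) auto
    ultimately show "emeasure (distr (\<mu> \<Otimes>\<^sub>M \<nu>) borel snd) A = emeasure \<nu> A"
      using A by (simp add: emeasure_distr m.emeasure_space_1)
  qed (simp add: sets)
  moreover have "sets (\<mu> \<Otimes>\<^sub>M \<nu>) = sets (borel \<Otimes>\<^sub>M borel)" by (rule sets_pair_measure_cong) (rule sets)+
  ultimately show ?thesis by (simp add: couplings_def P.prob_space_axioms)
qed

lemma return_in_Wasserstein_space:
  "return borel (x :: 'a::{real_normed_vector, second_countable_topology}) \<in> Wasserstein_space p"
proof -
  have "(\<integral>\<^sup>+ y. ennreal (norm y powr p) \<partial>return borel x) = ennreal (norm x powr p)"
    by (rule nn_integral_return) auto
  then show ?thesis by (auto simp: Wasserstein_space_def prob_space_return)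
qed

context
  fixes p :: real assumes p1: "1 \<le> p"
begin

lemma Wasserstein_spaceD:
  fixes \<mu> :: "'a::{real_normed_vector, second_countable_topology} measure"
  assumes "\<mu> \<in> Wasserstein_space p"
  shows "prob_space \<mu>" "sets \<mu> = sets borel" "integrable \<mu> (\<lambda>y. norm (y - x) powr p)"
proof -
  show 1: "prob_space \<mu>" and 2: "sets \<mu> = sets borel"
    using assms by (auto simp: Wasserstein_space_def)
  have [measurable_cong]: "sets \<mu> = sets borel" by fact
  have "integrable \<mu> (\<lambda>x. norm x powr p)"
    using assms by (intro integrableI_nonneg) (auto simp: Wasserstein_space_def)
  then show "integrable \<mu> (\<lambda>y. norm (y - x) powr p)"
    using p1 by (intro integrable_norm_diff_powr 1 2) auto
qed

lemma nn_integral_pmoment: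
  fixes \<mu> :: "'a::{real_normed_vector, second_countable_topology} measure"
  assumes "\<mu> \<in> Wasserstein_space p"
  shows "(\<integral>\<^sup>+ y. ennreal (norm (y - x) powr p) \<partial>\<mu>) = ennreal (pmoment p \<mu> x)"
  unfolding pmoment_def by (rule nn_integral_eq_integral) (auto intro: Wasserstein_spaceD[OF assms])

text \<open>In every coupling with a Dirac measure the second coordinate is almost surely
  \<open>x\<close>, so all couplings have the same cost.\<close>

lemma wasserstein_dist_return:
  fixes \<mu> :: "'a::{real_normed_vector, second_countable_topology} measure"
  assumes \<mu>: "\<mu> \<in> Wasserstein_space p"
  shows "wasserstein_dist p \<mu> (return borel x) = pmoment p \<mu> x powr (1 / p)"
proof -
  have "(INF \<pi>\<in>couplings \<mu> (return borel x). cost p \<pi>) = ennreal (pmoment p \<mu> x)"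
  proof (rule INF_eq_const)
    interpret prob_space \<mu> by (rule Wasserstein_spaceD[OF \<mu>])
    show "couplings \<mu> (return borel x) \<noteq> {}"
      using map_coupling(1)[OF Wasserstein_spaceD(1,2)[OF \<mu>], of "\<lambda>_. x"] by auto
    fix \<pi> assume \<pi>: "\<pi> \<in> couplings \<mu> (return borel x)"
    note [measurable] = couplingsD(1,2)[OF \<pi>]
    have "AE y in distr \<pi> borel snd. y = x"
      unfolding couplingsD(5)[OF \<pi>] by (subst AE_return) auto
    then have "AE z in \<pi>. snd z = x" by (subst (asm) AE_distr_iff) auto
    then have "cost p \<pi> = (\<integral>\<^sup>+ z. ennreal (norm (fst z - x) powr p) \<partial>\<pi>)"
      unfolding cost_def by (intro nn_integral_cong_AE) (auto elim!: eventually_mono)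
    also have "\<dots> = ennreal (pmoment p \<mu> x)"
      using coupling_nn_integral(1)[OF \<pi>, of "\<lambda>y. ennreal (norm (y - x) powr p)"] nn_integral_pmoment[OF \<mu>] by simp
    finally show "cost p \<pi> = ennreal (pmoment p \<mu> x)" .
  qed
  then show ?thesis by (simp add: wasserstein_dist_cost pmoment_nonneg)
qed

lemma powr_inverse_eq_iff: "a \<ge> 0 \<Longrightarrow> b \<ge> 0 \<Longrightarrow> a powr (1 / p) = b powr (1 / p) \<longleftrightarrow> a = b"
proof
  assume ab: "a \<ge> 0" "b \<ge> 0" and "a powr (1 / p) = b powr (1 / p)"
  then have "(a powr (1 / p)) powr p = (b powr (1 / p)) powr p" by simp
  then show "a = b" using p1 ab by (simp add: powr_powr)
qed simp

lemma wasserstein_dist_return_return: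
  fixes x y :: "'a::{real_normed_vector, second_countable_topology}"
  shows "wasserstein_dist p (return borel x) (return borel y) = dist x y"
proof -
  have "pmoment p (return borel x) y = norm (x - y) powr p"
    unfolding pmoment_def by (rule integral_return) auto
  then show ?thesis using p1
    by (simp add: wasserstein_dist_return[OF return_in_Wasserstein_space] powr_powr dist_norm)
qed

text \<open>The witness \<open>\<eta>\<close> is the image of \<open>\<nu>\<close> under dilation by
  2 about \<open>x\<close>. The graph coupling bounds its distance to \<open>\<nu>\<close> from
  above; integrating \<open>norm_diff_powr_le\<close> over an arbitrary coupling bounds it from
  below.\<close>

lemma dilatable_return:
  "dilatable p (return borel (x :: 'a::{real_normed_vector, second_countable_topology}))"
  unfolding dilatable_def
proof
  fix \<nu> :: "'a measure" assume \<nu>: "\<nu> \<in> Wasserstein_space p"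
  note \<nu>D = Wasserstein_spaceD[OF \<nu>]
  interpret prob_space \<nu> by (rule \<nu>D)
  have [measurable_cong]: "sets \<nu> = sets borel" by (rule \<nu>D)
  define f where "f y = 2 *\<^sub>R y - x" for y :: 'a
  have fm [measurable]: "f \<in> borel_measurable borel" unfolding f_def by measurable
  define \<eta> where "\<eta> = distr \<nu> borel f"
  define m where "m = pmoment p \<nu> x"
  have fx: "norm (f y - x) powr p = 2 powr p * norm (y - x) powr p" for y
  proof -
    have "f y - x = 2 *\<^sub>R (y - x)" by (simp add: f_def scaleR_2)
    then show ?thesis by (simp add: powr_mult)
  qed
  have \<eta>: "\<eta> \<in> Wasserstein_space p"
  proof (rule Wasserstein_spaceI)
    show "prob_space \<eta>" "sets \<eta> = sets borel" by (auto simp: \<eta>_def intro!: prob_space_distr)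
    have "norm (f y) powr p = 2 powr p * norm (y - (1/2) *\<^sub>R x) powr p" for y
    proof -
      have "f y = 2 *\<^sub>R (y - (1/2) *\<^sub>R x)" by (simp add: f_def scaleR_diff_right)
      then show ?thesis by (simp add: powr_mult)
    qed
    then show "integrable \<eta> (\<lambda>y. norm y powr p)"
      unfolding \<eta>_def by (subst integrable_distr_eq) (auto intro!: \<nu>D)
  qed
  have \<eta>m: "pmoment p \<eta> x = 2 powr p * m"
    unfolding pmoment_def \<eta>_def m_def by (subst integral_distr) (auto simp: fx)
  have "wasserstein_dist p \<eta> (return borel x) = 2 * wasserstein_dist p \<nu> (return borel x)"
    using p1 by (simp add: wasserstein_dist_return \<nu> \<eta> \<eta>m powr_mult powr_powr m_def pmoment_nonneg)
  moreover have "(INF \<pi>\<in>couplings \<nu> \<eta>. cost p \<pi>) = ennreal m"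
  proof (rule antisym)
    have "(INF \<pi>\<in>couplings \<nu> \<eta>. cost p \<pi>) \<le> cost p (distr \<nu> (borel \<Otimes>\<^sub>M borel) (\<lambda>y. (y, f y)))"
      unfolding \<eta>_def by (intro INF_lower map_coupling(1) \<nu>D fm)
    also have "\<dots> = (\<integral>\<^sup>+ y. ennreal (norm (y - x) powr p) \<partial>\<nu>)"
    proof -
      have "y - f y = x - y" for y by (simp add: f_def scaleR_2)
      then show ?thesis by (subst map_coupling(2)[OF \<nu>D(1,2) fm]) (simp add: norm_minus_commute)
    qed
    also have "\<dots> = ennreal m" by (simp add: nn_integral_pmoment[OF \<nu>] m_def)
    finally show "(INF \<pi>\<in>couplings \<nu> \<eta>. cost p \<pi>) \<le> ennreal m" .
    show "ennreal m \<le> (INF \<pi>\<in>couplings \<nu> \<eta>. cost p \<pi>)"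
    proof (rule INF_greatest)
      fix \<pi> assume \<pi>: "\<pi> \<in> couplings \<nu> \<eta>"
      note [measurable] = couplingsD(1,2)[OF \<pi>]
      show "ennreal m \<le> cost p \<pi>"
      proof (cases "cost p \<pi>")
        case (real c)
        have "ennreal (2 powr p * m) = (\<integral>\<^sup>+ z. ennreal (norm (snd z - x) powr p) \<partial>\<pi>)"
          using coupling_nn_integral(2)[OF \<pi>, of "\<lambda>y. ennreal (norm (y - x) powr p)"]
            nn_integral_pmoment[OF \<eta>, of x] \<eta>m by simp
        also have "\<dots> \<le> (\<integral>\<^sup>+ z. ennreal (2 powr (p - 1)) * (ennreal (norm (fst z - x) powr p) + ennreal (norm (fst z - snd z) powr p)) \<partial>\<pi>)"
        proof (intro nn_integral_mono)
          fix z :: "'a \<times> 'a"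
          have "norm (snd z - x) powr p \<le> 2 powr (p - 1) * (norm (snd z - fst z) powr p + norm (x - fst z) powr p)"
            using p1 by (rule norm_diff_powr_le)
          then have "ennreal (norm (snd z - x) powr p) \<le> ennreal (2 powr (p - 1) * (norm (fst z - x) powr p + norm (fst z - snd z) powr p))"
            by (intro ennreal_leI) (simp add: norm_minus_commute add.commute)
          then show "ennreal (norm (snd z - x) powr p) \<le> ennreal (2 powr (p - 1)) * (ennreal (norm (fst z - x) powr p) + ennreal (norm (fst z - snd z) powr p))"
            by (simp add: ennreal_mult')
        qed
        also have "\<dots> = ennreal (2 powr (p - 1)) * (ennreal m + cost p \<pi>)"
          using coupling_nn_integral(1)[OF \<pi>, of "\<lambda>y. ennreal (norm (y - x) powr p)"]
            nn_integral_pmoment[OF \<nu>, of x]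
          by (simp add: nn_integral_cmult nn_integral_add m_def cost_def)
        also have "\<dots> = ennreal (2 powr (p - 1) * (m + c))"
          using real by (simp add: ennreal_mult' m_def pmoment_nonneg)
        finally have "2 powr p * m \<le> 2 powr (p - 1) * (m + c)"
          using real by (subst (asm) ennreal_le_iff) (auto simp: m_def pmoment_nonneg)
        moreover have "(2::real) powr p = 2 powr (p - 1) * 2" by (simp add: powr_diff)
        ultimately have "2 powr (p - 1) * (2 * m) \<le> 2 powr (p - 1) * (m + c)" by simp
        then have "m \<le> c" by simp
        then show ?thesis using real by (simp add: ennreal_leI)
      qed simp
    qed
  qed
  then have "wasserstein_dist p \<nu> \<eta> = wasserstein_dist p \<nu> (return borel x)"
    by (simp add: wasserstein_dist_cost[of p \<nu> \<eta>] wasserstein_dist_return[OF \<nu>] m_def pmoment_nonneg)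
  ultimately show "\<exists>\<eta>\<in>Wasserstein_space p.
     wasserstein_dist p \<eta> (return borel x) = 2 * wasserstein_dist p \<nu> (return borel x) \<and>
     wasserstein_dist p \<nu> \<eta> = wasserstein_dist p \<nu> (return borel x)"
    using \<eta> by blast
qed

lemma pmoment_zero_imp_return:
  fixes \<mu> :: "'a::{real_normed_vector, second_countable_topology} measure"
  assumes \<mu>: "\<mu> \<in> Wasserstein_space p" and "pmoment p \<mu> x = 0"
  shows "\<mu> = return borel x"
proof (rule AE_eq_imp_return)
  have "AE y in \<mu>. norm (y - x) powr p = 0"
    using assms(2) Wasserstein_spaceD(3)[OF \<mu>, of x] unfolding pmoment_def
    by (subst (asm) integral_nonneg_eq_0_iff_AE) auto
  then show "AE y in \<mu>. y = x" by (auto elim!: eventually_mono)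
qed (rule Wasserstein_spaceD[OF \<mu>])+

text \<open>For the Dirac measure at \<open>y\<close>, the witness \<open>\<eta>\<close> has the
  same moment \<open>m\<close> about \<open>y\<close> as \<open>\<mu>\<close>. The product coupling
  costs at most \<open>2 powr p * m\<close>, and the distance requires at least that, so the
  triangle inequality through \<open>y\<close> is almost surely an equality. This forces
  \<open>\<eta>\<close>, and then \<open>\<mu>\<close>, to be the Dirac measure at
  \<open>y\<close>.\<close>

lemma dilatable_imp_return:
  fixes \<mu> :: "'a::{real_inner, second_countable_topology} measure"
  assumes \<mu>: "\<mu> \<in> Wasserstein_space p" and dil: "dilatable p \<mu>"
  shows "\<exists>x. \<mu> = return borel x"
proof (rule ccontr)
  assume nd: "\<nexists>x. \<mu> = return borel x"
  note \<mu>D = Wasserstein_spaceD[OF \<mu>]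
  obtain a1 a2 where a12: "a1 \<noteq> a2" "\<And>C. closed C \<Longrightarrow> AE y in \<mu>. y \<in> C \<Longrightarrow> a1 \<in> C \<and> a2 \<in> C"
    by (rule not_return_imp_two_support_points[OF \<mu>D(1,2)]) (use nd in blast, rule that)
  \<comment> \<open>Almost every point of \<open>\<mu>\<close> lies on one ray issuing from \<open>y\<close>; no ray issuing from the midpoint
    contains both \<open>a1\<close> and \<open>a2\<close>.\<close>
  define y where "y = (1/2) *\<^sub>R (a1 + a2)"
  define m where "m = pmoment p \<mu> y"
  obtain \<eta> where \<eta>: "\<eta> \<in> Wasserstein_space p"
    "wasserstein_dist p \<eta> \<mu> = 2 * wasserstein_dist p (return borel y) \<mu>"
    "wasserstein_dist p (return borel y) \<eta> = wasserstein_dist p (return borel y) \<mu>"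
    using bspec[OF dil[unfolded dilatable_def] return_in_Wasserstein_space[of y p]] by blast
  note \<eta>D = Wasserstein_spaceD[OF \<eta>(1)]
  have m0: "m \<ge> 0" by (simp add: m_def pmoment_nonneg)
  have Wm: "wasserstein_dist p (return borel y) \<mu> = m powr (1 / p)"
    using wasserstein_dist_return[OF \<mu>, of y] wasserstein_dist_sym[of p \<mu> "return borel y"] by (simp add: m_def)
  have \<eta>m: "pmoment p \<eta> y = m"
  proof -
    have "pmoment p \<eta> y powr (1 / p) = m powr (1 / p)"
      using \<eta>(3) Wm wasserstein_dist_return[OF \<eta>(1), of y] wasserstein_dist_sym[of p \<eta> "return borel y"] by simp
    then show ?thesis by (simp add: powr_inverse_eq_iff pmoment_nonneg m0)
  qed
  interpret e: prob_space \<eta> by (rule \<eta>D)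
  interpret u: prob_space \<mu> by (rule \<mu>D)
  interpret P: pair_prob_space \<eta> \<mu> ..
  have [measurable_cong]: "sets \<mu> = sets borel" "sets \<eta> = sets borel" by (rule \<mu>D \<eta>D)+
  let ?P = "\<eta> \<Otimes>\<^sub>M \<mu>"
  have i1: "integrable ?P (\<lambda>z. norm (fst z - y) powr p)"
    using \<eta>D(3) by (intro P.Fubini_integrable) auto
  have i2: "integrable ?P (\<lambda>z. norm (snd z - y) powr p)"
    using \<mu>D(3) by (intro P.Fubini_integrable) auto
  have v1: "(\<integral>z. norm (fst z - y) powr p \<partial>?P) = m"
    using P.integral_fst'[OF i1] \<eta>m by (simp add: pmoment_def u.prob_space)
  have v2: "(\<integral>z. norm (snd z - y) powr p \<partial>?P) = m"
    using P.integral_fst'[OF i2] by (simp add: pmoment_def m_def e.prob_space)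
  define g where "g z = 2 powr (p - 1) * (norm (fst z - y) powr p + norm (snd z - y) powr p)" for z
  have ig: "integrable ?P g" unfolding g_def using i1 i2 by simp
  have vg: "(\<integral>z. g z \<partial>?P) = 2 powr p * m"
    unfolding g_def using i1 i2 v1 v2 by (simp add: powr_diff)
  have le: "norm (fst z - snd z) powr p \<le> g z" for z
    unfolding g_def using p1 by (rule norm_diff_powr_le)
  have ic: "integrable ?P (\<lambda>z. norm (fst z - snd z) powr p)"
  proof (rule Bochner_Integration.integrable_bound[OF ig])
    show "AE z in ?P. norm (norm (fst z - snd z) powr p) \<le> norm (g z)"
      using le by (intro AE_I2) (auto intro: order_trans[OF _ abs_ge_self])
  qed measurable
  define c where "c = (\<integral>z. norm (fst z - snd z) powr p \<partial>?P)"
  \<comment> \<open>The prescribed distance from \<open>\<eta>\<close> to \<open>\<mu>\<close>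
    bounds the cost of every coupling from below, in particular that of the product.\<close>
  have "2 powr p * m \<le> c"
  proof -
    define I where "I = (INF \<pi>\<in>couplings \<eta> \<mu>. cost p \<pi>)"
    have "enn2real I powr (1 / p) = (2 powr p * m) powr (1 / p)"
      using \<eta>(2) Wm p1 by (simp add: wasserstein_dist_cost[of p \<eta>] I_def powr_mult powr_powr m0)
    then have "enn2real I = 2 powr p * m" by (subst (asm) powr_inverse_eq_iff) (auto simp: m0)
    moreover have "I \<le> cost p ?P"
      unfolding I_def by (intro INF_lower product_coupling \<eta>D(1,2) \<mu>D(1,2))
    moreover have "cost p ?P = ennreal c"
      unfolding cost_def c_def using ic by (intro nn_integral_eq_integral) auto
    moreover have "enn2real (ennreal c) = c" by (simp add: c_def)
    ultimately show ?thesis using enn2real_mono[of I "ennreal c"] by simp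
  qed
  then have "(\<integral>z. g z - norm (fst z - snd z) powr p \<partial>?P) \<le> 0"
    using vg ig ic by (simp add: c_def)
  moreover have "(\<integral>z. g z - norm (fst z - snd z) powr p \<partial>?P) \<ge> 0"
    using le by (intro integral_nonneg_AE) auto
  ultimately have "(\<integral>z. g z - norm (fst z - snd z) powr p \<partial>?P) = 0" by simp
  then have "AE z in ?P. g z - norm (fst z - snd z) powr p = 0"
    using ig ic le by (subst (asm) integral_nonneg_eq_0_iff_AE) auto
  then have "AE z in ?P. norm (fst z - snd z) = norm (fst z - y) + norm (snd z - y)"
    by eventually_elim (rule norm_diff_powr_eqD[OF p1], simp add: g_def)
  from P.AE_pair[OF this]
  have "AE b in \<eta>. AE a in \<mu>. a \<in> {a. norm (b - a) = norm (b - y) + norm (a - y)}" by simp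
  then have "AE b in \<eta>. b = y"
  proof eventually_elim
    case (elim b)
    define v where "v = a1 - y"
    define d where "d = b - y"
    \<comment> \<open>A closed condition that holds almost everywhere holds at the support points
      \<open>a1\<close> and \<open>a2\<close>.\<close>
    have "closed {a. norm (b - a) = norm (b - y) + norm (a - y)}"
      by (intro closed_Collect_eq continuous_intros)
    from a12(2)[OF this elim]
    have *: "norm (b - a1) = norm (b - y) + norm (a1 - y)" "norm (b - a2) = norm (b - y) + norm (a2 - y)"
      by simp_all
    have "2 *\<^sub>R y = a1 + a2" by (simp add: y_def)
    then have "a2 = y + y - a1" by (simp add: scaleR_2)
    then have s: "a2 - y = - v" by (simp add: v_def)
    have "v \<noteq> 0" using s a12(1) by (auto simp: v_def)
    have "b - a2 = d - (a2 - y)" by (simp add: d_def)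
    then have "b - a2 = d + v" using s by simp
    moreover have "b - a1 = d - v" by (simp add: d_def v_def)
    ultimately have e: "norm (d - v) = norm d + norm v" "norm (d + v) = norm d + norm v"
      using * unfolding s by (simp_all add: d_def[symmetric] v_def[symmetric])
    \<comment> \<open>The parallelogram law: both norms on the left equal
      \<open>norm d + norm v\<close>, so the mixed term must vanish.\<close>
    have "(norm (d - v))\<^sup>2 + (norm (d + v))\<^sup>2 = 2 * (norm d)\<^sup>2 + 2 * (norm v)\<^sup>2"
      by (simp add: power2_norm_eq_inner inner_diff_left inner_diff_right inner_add_left inner_add_right)
    then have "norm d * norm v = 0" unfolding e by (simp add: power2_eq_square algebra_simps)
    with \<open>v \<noteq> 0\<close> show "b = y" by (simp add: d_def)
  qed
  then have "\<eta> = return borel y" by (rule AE_eq_imp_return[OF \<eta>D(1,2)])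
  then have "m = norm (y - y) powr p"
    unfolding \<eta>m[symmetric] pmoment_def by (simp only:) (rule integral_return; simp)
  then have "m = 0" by simp
  then have "\<mu> = return borel y" by (intro pmoment_zero_imp_return[OF \<mu>]) (simp add: m_def)
  with nd show False by blast
qed

end

section \<open>Rigidity\<close>

text \<open>Dilatability speaks only of distances between elements of the space, and surjectivity of
  \<open>\<Phi>\<close> transfers its quantifiers.\<close>

lemma dilatable_isometry_iff:
  assumes bij: "bij_betw \<Phi> (Wasserstein_space p) (Wasserstein_space p)"
    and iso: "\<forall>\<mu>\<in>Wasserstein_space p. \<forall>\<nu>\<in>Wasserstein_space p.
           wasserstein_dist p (\<Phi> \<mu>) (\<Phi> \<nu>) = wasserstein_dist p \<mu> \<nu>"
    and \<mu>: "\<mu> \<in> Wasserstein_space p"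
  shows "dilatable p (\<Phi> \<mu>) \<longleftrightarrow> dilatable p \<mu>"
proof -
  have im: "Wasserstein_space p = \<Phi> ` Wasserstein_space p" using bij by (simp add: bij_betw_def)
  have "dilatable p (\<Phi> \<mu>) \<longleftrightarrow> (\<forall>\<nu>\<in>\<Phi> ` Wasserstein_space p. \<exists>\<eta>\<in>\<Phi> ` Wasserstein_space p.
     wasserstein_dist p \<eta> (\<Phi> \<mu>) = 2 * wasserstein_dist p \<nu> (\<Phi> \<mu>) \<and>
     wasserstein_dist p \<nu> \<eta> = wasserstein_dist p \<nu> (\<Phi> \<mu>))"
    unfolding dilatable_def im[symmetric] ..
  also have "\<dots> \<longleftrightarrow> dilatable p \<mu>"
    unfolding dilatable_def using iso \<mu> by simp
  finally show ?thesis .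
qed

text \<open>The sort adds completeness and second countability to an inner product, which gives
  separable real Hilbert spaces. That \<open>\<psi>\<close> is affine follows from the Mazur--Ulam
  theorem.\<close>

theorem theorem3p10:
  fixes p :: real and \<Phi> :: "('a::{real_inner, polish_space}) measure \<Rightarrow> 'a measure"
  assumes "1 \<le> p"
    and "\<not> (\<exists>k::nat. p = 2 * real k)"
    and "bij_betw \<Phi> (Wasserstein_space p) (Wasserstein_space p)"
    and "\<forall>\<mu>\<in>Wasserstein_space p. \<forall>\<nu>\<in>Wasserstein_space p.
           wasserstein_dist p (\<Phi> \<mu>) (\<Phi> \<nu>) = wasserstein_dist p \<mu> \<nu>"
  shows "\<exists>\<psi> :: 'a \<Rightarrow> 'a. bij \<psi> \<and> (\<forall>x y. dist (\<psi> x) (\<psi> y) = dist x y) \<and>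
           (\<forall>\<mu>\<in>Wasserstein_space p. \<Phi> \<mu> = distr \<mu> borel \<psi>)"
proof -
  note p1 = assms(1)
  note iso = assms(4)[rule_format]
  note W_ret = return_in_Wasserstein_space[of _ p]
  have \<Phi>W: "\<Phi> \<mu> \<in> Wasserstein_space p" if "\<mu> \<in> Wasserstein_space p" for \<mu>
    using bij_betwE[OF assms(3)] that by blast
  have "\<exists>z. \<Phi> (return borel x) = return borel z" for x
  proof (rule dilatable_imp_return[OF p1 \<Phi>W[OF W_ret]])
    show "dilatable p (\<Phi> (return borel x))"
      unfolding dilatable_isometry_iff[OF assms(3,4) W_ret] by (rule dilatable_return[OF p1])
  qed
  then obtain \<psi> where \<psi>: "\<And>x. \<Phi> (return borel x) = return borel (\<psi> x)" by metis
  have dist: "dist (\<psi> x) (\<psi> y) = dist x y" for x y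
    using iso[OF W_ret[of x] W_ret[of y]] by (simp add: \<psi> wasserstein_dist_return_return[OF p1])
  \<comment> \<open>The preimage of a Dirac measure under \<open>\<Phi>\<close> is dilatable, hence
    again a Dirac measure.\<close>
  have "\<exists>x. \<psi> x = z" for z
  proof -
    obtain \<mu> where \<mu>: "\<mu> \<in> Wasserstein_space p" "\<Phi> \<mu> = return borel z"
      using W_ret[of z] bij_betw_imp_surj_on[OF assms(3)] by (metis imageE)
    have "dilatable p \<mu>"
      using dilatable_isometry_iff[OF assms(3,4) \<mu>(1)] dilatable_return[OF p1, of z] by (simp add: \<mu>(2))
    then obtain x where "\<mu> = return borel x" using dilatable_imp_return[OF p1 \<mu>(1)] by blast
    then have "return borel (\<psi> x) = return borel z" using \<mu>(2) \<psi> by simp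
    then have "dist (\<psi> x) z = 0" by (metis wasserstein_dist_return_return[OF p1] dist_self)
    then show ?thesis by auto
  qed
  moreover have "inj \<psi>"
    by (rule injI) (metis dist dist_eq_0_iff)
  ultimately have bij: "bij \<psi>" unfolding bij_def surj_def by metis
  have "continuous_on UNIV \<psi>"
    unfolding continuous_on_iff dist by blast
  then have \<psi>m [measurable]: "\<psi> \<in> borel_measurable borel" by (rule borel_measurable_continuous_onI)
  have "\<Phi> \<mu> = distr \<mu> borel \<psi>" if \<mu>: "\<mu> \<in> Wasserstein_space p" for \<mu>
  proof -
    note \<mu>D = Wasserstein_spaceD[OF p1 \<mu>]
    note \<Phi>D = Wasserstein_spaceD[OF p1 \<Phi>W[OF \<mu>]]
    have [measurable_cong]: "sets \<mu> = sets borel" by (rule \<mu>D)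
    have norm_\<psi>: "norm (\<psi> y - \<psi> x) = norm (y - x)" for x y
      using dist[of y x] by (simp add: dist_norm)
    \<comment> \<open>\<open>\<psi>\<close> may move the origin; the norm of \<open>\<psi> y\<close>
      is the distance from \<open>y\<close> to \<open>x0\<close>.\<close>
    obtain x0 where x0: "\<psi> x0 = 0" using bij by (metis bij_pointE)
    have int: "integrable (distr \<mu> borel \<psi>) (\<lambda>y. norm y powr p)"
      using norm_\<psi>[of _ x0] \<mu>D(3)[of x0] by (subst integrable_distr_eq) (auto simp: x0)
    have pr: "prob_space (distr \<mu> borel \<psi>)"
      by (rule prob_space.prob_space_distr[OF \<mu>D(1)]) measurable
    show ?thesis
    proof (rule potential_determines_measure[OF \<Phi>D(1) pr \<Phi>D(2) _ _ assms(2) _ int])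
      show "integrable (\<Phi> \<mu>) (\<lambda>x. norm x powr p)" using \<Phi>D(3)[of 0] by simp
      fix z
      \<comment> \<open>Both potentials at \<open>z = \<psi> x\<close> equal that of
        \<open>\<mu>\<close> at \<open>x\<close>: for \<open>\<Phi> \<mu>\<close> through the
        distance to a Dirac measure, for the push-forward by change of variables.\<close>
      obtain x where x: "z = \<psi> x" using bij by (metis bij_pointE)
      have "pmoment p (\<Phi> \<mu>) z powr (1 / p) = wasserstein_dist p (\<Phi> \<mu>) (\<Phi> (return borel x))"
        unfolding \<psi> x by (rule wasserstein_dist_return[OF p1 \<Phi>W[OF \<mu>], symmetric])
      also have "\<dots> = pmoment p \<mu> x powr (1 / p)"
        by (simp add: iso[OF \<mu> W_ret] wasserstein_dist_return[OF p1 \<mu>])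
      finally have "pmoment p (\<Phi> \<mu>) z = pmoment p \<mu> x"
        by (simp add: powr_inverse_eq_iff[OF p1] pmoment_nonneg)
      also have "\<dots> = (\<integral>y. norm (y - z) powr p \<partial>distr \<mu> borel \<psi>)"
        unfolding pmoment_def x by (subst integral_distr) (auto simp: norm_\<psi>)
      finally show "(\<integral>y. norm (y - z) powr p \<partial>\<Phi> \<mu>) = (\<integral>y. norm (y - z) powr p \<partial>distr \<mu> borel \<psi>)"
        unfolding pmoment_def .
    qed (use p1 in auto)
  qed
  with bij dist show ?thesis by blast
qed

end
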